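(* Let $G=SL(3,\mathbb{C})$, and let $G_1,G_0,B,B_1,B_0$, the characters $\chi_{n_1,n_2}$ of $B$, $\chi^1_{n_1,n_2}$ of $B_1$, $\chi^0_{n}$ of $B_0$, the spaces of sections $H^0$, the coordinates $p=(p_1,p_2,p_3)$, $q=(q_1,q_2,q_3)$ and the varieties $\overline{G_1/U_1}$, $\overline{G_0/U_0}$ be as defined in the context. (1) If $n_1<0$, then for every $n_2\in\mathbb{Z}$ $$H^0(G_1/B_1,\chi^1_{n_1,n_2})\simeq H^0(G_0/B_0,\chi^0_{n_1})=\{0\}.$$ (2) If $n_1\ge 0$, then for every $n_2\in\mathbb{Z}$ the space $H^0(G_1/B_1,\chi^1_{n_1,n_2})$ is infinite dimensional. More precisely, $$H^0(G_1/B_1,\chi^1_{n_1,n_2})\simeq \bigcup_{l=\sup(0,-n_2)}^{\infty}\frac{1}{q_3^{\,l}}\,H^0(G/B,\chi_{n_1,l+n_2}),$$ and $$\bigoplus_{n_1=0}^{\infty}\ \bigoplus_{n_2\in\mathbb{Z}} H^0(G_1/B_1,\chi^1_{n_1,n_2})=\mathcal{O}\bigl(\overline{G_1/U_1}\cap\{q_3\neq 0\}\bigr).$$ (3) Similarly, for $n_1\ge 0$, $$H^0(G_0/B_0,\chi^0_{n_1})\simeq \bigcup_{l=0}^{\infty} H^0(G/B,\chi_{n_1,l})\big|_{q_3=1},$$ and $$\bigoplus_{n_1=0}^{\infty} H^0(G_0/B_0,\chi^0_{n_1})\simeq \mathcal{O}\bigl(\overline{G_0/U_0}\bigr).$$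
   Context: Write an element of $G=SL(3,\mathbb{C})$ as the matrix $g$ with columns $x=(x_1,x_2,x_3)^T$, $y=(y_1,y_2,y_3)^T$, $z=(z_1,z_2,z_3)^T$. Set $G_1=\{g\in G: z_1=z_2=0\}$ and $G_0=\{g\in G: z_1=z_2=0,\ z_3=1\}$. $B\subset G$ is the subgroup of upper triangular matrices $b=\begin{pmatrix}a_1&b_1&c_1\\0&b_2&c_2\\0&0&c_3\end{pmatrix}$ of determinant 1, and $U\subset B$ is the subgroup of upper triangular matrices with all diagonal entries $1$. Put $B_i=B\cap G_i$ and $U_i=U\cap G_i$ for $i=0,1$. Characters: $\chi_{n_1,n_2}(b)=a_1^{-n_1}c_3^{n_2}$ on $B$ and $\chi^1_{n_1,n_2}(b)=a_1^{-n_1}c_3^{n_2}$ on $B_1$ ($n_1,n_2\in\mathbb{Z}$); $\chi^0_{n}(b)=a_1^{-n}$ on $B_0$ ($n\in\mathbb{Z}$). Sections: for $(H,K,\chi)$ equal to $(G,B,\chi_{n_1,n_2})$, $(G_1,B_1,\chi^1_{n_1,n_2})$ or $(G_0,B_0,\chi^0_n)$, $H^0(H/K,\chi)$ denotes the space of sections of the line bundle $H\times_\chi\mathbb{C}\to H/K$, i.e. the space of regular functions $f:H\to\mathbb{C}$ on the algebraic group $H$ such that $f(gb)=\chi(b)^{-1}f(g)$ for all $g\in H$, $b\in K$. Coordinates: for a matrix $g\in G$ with columns $x=(x_1,x_2,x_3)^T$, $y=(y_1,y_2,y_3)^T$, $z=(z_1,z_2,z_3)^T$ put $p_i=x_i$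 ($i=1,2,3$) and $q_1=x_2y_3-x_3y_2$, $q_2=x_3y_1-x_1y_3$, $q_3=x_1y_2-x_2y_1$; write $p.q=p_1q_1+p_2q_2+p_3q_3$, which vanishes identically. The map $g\mapsto(p,q)$ identifies $G/U\simeq\{(p,q)\in\mathbb{C}^6: p\ne0,\ q\neq 0,\ p.q=0\}$, $G_1/U_1\simeq\{(p,q)\in\mathbb{C}^6: p\neq0,\ q_3\ne0,\ p.q=0\}$, $G_0/U_0\simeq\{(p,q)\in\mathbb{C}^6: p\ne0,\ q_3=1,\ p.q=0\}$. The closures used are $\overline{G_1/U_1}=\overline{G/U}=\{(p,q)\in\mathbb{C}^6: p.q=0\}$ and $\overline{G_0/U_0}=\{(p,q)\in\mathbb{C}^6: q_3=1,\ p.q=0\}$ (the points $(p,q)$ of $\mathbb{C}^6$ being viewed as the points $[p:q:1]$ of $\mathbb{P}(\mathbb{C}^7)$). $\mathcal{O}(\cdot)$ denotes the algebra of regular functions; thus $\mathcal{O}(\overline{G_1/U_1}\cap\{q_3\ne0\})$ consists of the functions $F(p,q)/q_3^l$ with $F$ polynomial and $l\ge0$. Functions in $H^0(G/B,\chi_{n_1,n_2})$ ($n_1,n_2\ge0$) are identified with the functions on $\{p.q=0\}$ induced by polynomials in $(p,q)$ homogeneous of degree $n_1$ in $p$ and $n_2$ in $q$; right $U_1$-invariant functions on $G_1$ (resp. right $U_0$-invariant functions on $G_0$) are identified with functions of $(p,q)$ on $G_1/U_1$ (resp. $G_0/U_0$). All unions are unions of subspaces of the corresponding space of functions of $(p,q)$,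 and $|_{q_3=1}$ means restriction to $\{q_3=1\}$. *)

theory Defs
  imports "HOL-Analysis.Analysis" "HOL-Library.Function_Algebras"
begin

text \<open>
  A function on a subset X of a type is represented by its extension by 0 to the whole type, so
  that the functions on X form a subspace of a complex vector space of functions.
\<close>

definition on_set :: "'a set \<Rightarrow> ('a \<Rightarrow> complex) \<Rightarrow> 'a \<Rightarrow> complex" where
  "on_set X f = (\<lambda>x. if x \<in> X then f x else 0)"

definition fscale :: "complex \<Rightarrow> ('a \<Rightarrow> complex) \<Rightarrow> 'a \<Rightarrow> complex" where
  "fscale c f = (\<lambda>x. c * f x)"

interpretation fun_space: vector_space "fscale :: complex \<Rightarrow> ('a \<Rightarrow> complex) \<Rightarrow> 'a \<Rightarrow> complex"
  by unfold_locales (auto simp: fscale_def fun_eq_iff algebra_simps)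

definition finite_dimensional :: "('a \<Rightarrow> complex) set \<Rightarrow> bool" where
  "finite_dimensional V \<longleftrightarrow> (\<exists>S. finite S \<and> S \<subseteq> V \<and> V \<subseteq> fun_space.span S)"

definition linear_iso ::
  "(('a \<Rightarrow> complex) \<Rightarrow> 'b \<Rightarrow> complex) \<Rightarrow> ('a \<Rightarrow> complex) set \<Rightarrow> ('b \<Rightarrow> complex) set \<Rightarrow> bool" where
  "linear_iso \<phi> V W \<longleftrightarrow> fun_space.subspace V \<and> fun_space.subspace W \<and>
     Vector_Spaces.linear fscale fscale \<phi> \<and> bij_betw \<phi> V W"

definition isomorphic :: "('a \<Rightarrow> complex) set \<Rightarrow> ('b \<Rightarrow> complex) set \<Rightarrow> bool" where
  "isomorphic V W \<longleftrightarrow> (\<exists>\<phi>. linear_iso \<phi> V W)"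

definition is_direct_sum ::
  "'i set \<Rightarrow> ('i \<Rightarrow> ('a \<Rightarrow> complex) set) \<Rightarrow> ('a \<Rightarrow> complex) set \<Rightarrow> bool" where
  "is_direct_sum I V W \<longleftrightarrow>
     (\<forall>i\<in>I. fun_space.subspace (V i)) \<and>
     W = fun_space.span (\<Union>i\<in>I. V i) \<and>
     (\<forall>J v. finite J \<and> J \<subseteq> I \<and> (\<forall>j\<in>J. v j \<in> V j) \<and> (\<Sum>j\<in>J. v j) = 0 \<longrightarrow> (\<forall>j\<in>J. v j = 0))"

text \<open>Polynomials in a given set C of coordinate functions.\<close>

inductive_set poly_funs :: "('a \<Rightarrow> complex) set \<Rightarrow> ('a \<Rightarrow> complex) set" for C where
  const: "(\<lambda>_. c) \<in> poly_funs C"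
| coord: "f \<in> C \<Longrightarrow> f \<in> poly_funs C"
| add: "f \<in> poly_funs C \<Longrightarrow> g \<in> poly_funs C \<Longrightarrow> (\<lambda>x. f x + g x) \<in> poly_funs C"
| mult: "f \<in> poly_funs C \<Longrightarrow> g \<in> poly_funs C \<Longrightarrow> (\<lambda>x. f x * g x) \<in> poly_funs C"

text \<open>
  Regular functions on a Zariski closed subset X of an affine space are the restrictions of
  polynomials; on the principal open subset of X where h does not vanish they are the quotients of
  polynomials by powers of h.
\<close>

definition regular_funs :: "('a \<Rightarrow> complex) set \<Rightarrow> 'a set \<Rightarrow> ('a \<Rightarrow> complex) set" where
  "regular_funs C X = on_set X ` poly_funs C"

definition regular_funs_principal ::
  "('a \<Rightarrow> complex) set \<Rightarrow> 'a set \<Rightarrow> ('a \<Rightarrow> complex) \<Rightarrow> ('a \<Rightarrow> complex) set" where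
  "regular_funs_principal C X h =
     {on_set (X \<inter> {w. h w \<noteq> 0}) (\<lambda>w. F w / h w ^ l) | F (l::nat). F \<in> poly_funs C}"

type_synonym mat3 = "complex^3^3"

definition mat_coords :: "(mat3 \<Rightarrow> complex) set" where
  "mat_coords = {\<lambda>g. g $ i $ j | i j. True}"

definition G :: "mat3 set" where
  "G = {g. det g = 1}"

definition G1 :: "mat3 set" where
  "G1 = {g \<in> G. g $ 1 $ 3 = 0 \<and> g $ 2 $ 3 = 0}"

definition G0 :: "mat3 set" where
  "G0 = {g \<in> G. g $ 1 $ 3 = 0 \<and> g $ 2 $ 3 = 0 \<and> g $ 3 $ 3 = 1}"

text \<open>
  The vanishing entries are listed because in the index type \<^typ>\<open>3\<close> the numerals 3 and 0 denote
  the same element, so its order is not the order 1, 2, 3 of rows and columns.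
\<close>

definition B :: "mat3 set" where
  "B = {b \<in> G. b $ 2 $ 1 = 0 \<and> b $ 3 $ 1 = 0 \<and> b $ 3 $ 2 = 0}"

definition B1 :: "mat3 set" where "B1 = B \<inter> G1"

definition B0 :: "mat3 set" where "B0 = B \<inter> G0"

definition chi :: "int \<Rightarrow> int \<Rightarrow> mat3 \<Rightarrow> complex" where
  "chi n1 n2 b = (b $ 1 $ 1) powi (- n1) * (b $ 3 $ 3) powi n2"

definition chi1 :: "int \<Rightarrow> int \<Rightarrow> mat3 \<Rightarrow> complex" where
  "chi1 n1 n2 b = (b $ 1 $ 1) powi (- n1) * (b $ 3 $ 3) powi n2"

definition chi0 :: "int \<Rightarrow> mat3 \<Rightarrow> complex" where
  "chi0 n b = (b $ 1 $ 1) powi (- n)"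

definition H0 :: "mat3 set \<Rightarrow> mat3 set \<Rightarrow> (mat3 \<Rightarrow> complex) \<Rightarrow> (mat3 \<Rightarrow> complex) set" where
  "H0 H K ch = {f \<in> regular_funs mat_coords H.
     \<forall>g\<in>H. \<forall>b\<in>K. f (g ** b) = inverse (ch b) * f g}"

type_synonym pq = "(complex^3) \<times> (complex^3)"

text \<open>p is the first column x, and q is the cross product of the first two columns x and y.\<close>

definition pq_of :: "mat3 \<Rightarrow> pq" where
  "pq_of g = (let x = column 1 g; y = column 2 g in
     (x, vector [x$2 * y$3 - x$3 * y$2, x$3 * y$1 - x$1 * y$3, x$1 * y$2 - x$2 * y$1]))"

definition q3 :: "pq \<Rightarrow> complex" where
  "q3 w = snd w $ 3"

definition p_dot_q :: "pq \<Rightarrow> complex" where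
  "p_dot_q w = (\<Sum>i\<in>UNIV. fst w $ i * snd w $ i)"

definition pq_coords :: "(pq \<Rightarrow> complex) set" where
  "pq_coords = {\<lambda>w. fst w $ i | i. True} \<union> {\<lambda>w. snd w $ i | i. True}"

text \<open>
  The quotients by the unipotent groups, in the coordinates (p,q), and their closures in the
  six-dimensional affine space.
\<close>

definition GU :: "pq set" where
  "GU = {w. fst w \<noteq> 0 \<and> snd w \<noteq> 0 \<and> p_dot_q w = 0}"

definition G1U1 :: "pq set" where
  "G1U1 = {w. fst w \<noteq> 0 \<and> q3 w \<noteq> 0 \<and> p_dot_q w = 0}"

definition G0U0 :: "pq set" where
  "G0U0 = {w. fst w \<noteq> 0 \<and> q3 w = 1 \<and> p_dot_q w = 0}"

definition G1U1_closure :: "pq set" where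
  "G1U1_closure = {w. p_dot_q w = 0}"

definition G0U0_closure :: "pq set" where
  "G0U0_closure = {w. q3 w = 1 \<and> p_dot_q w = 0}"

text \<open>
  The identification of functions of (p,q) with right invariant functions on the group H is the
  pullback along \<^const>\<open>pq_of\<close>.
\<close>

definition pullback :: "mat3 set \<Rightarrow> (pq \<Rightarrow> complex) \<Rightarrow> mat3 \<Rightarrow> complex" where
  "pullback H F = on_set H (F \<circ> pq_of)"

text \<open>
  The sections over G/B, seen as functions of (p,q) on G/U. Since G/U contains \<^const>\<open>G1U1\<close> and
  \<^const>\<open>G0U0\<close>, they can be restricted to these sets.
\<close>

definition H0_GB_pq :: "int \<Rightarrow> int \<Rightarrow> (pq \<Rightarrow> complex) set" where
  "H0_GB_pq n1 n2 = {F. on_set GU F = F \<and> pullback G F \<in> H0 G B (chi n1 n2)}"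

end

theory Submission
  imports Defs "HOL-Computational_Algebra.Polynomial"
begin

text \<open>
  A point of \<open>G0/B0\<close> is given by \<open>[x\<^sub>1 : x\<^sub>2]\<close> on the projective line together with \<open>(q\<^sub>1, q\<^sub>2)\<close>.
  Hence a section \<open>f\<close> of degree \<open>n\<close> over \<open>G0/B0\<close> equals \<open>x\<^sub>1\<^sup>n P(x\<^sub>2/x\<^sub>1, q\<^sub>1, q\<^sub>2)\<close> where \<open>x\<^sub>1 \<noteq> 0\<close>
  and \<open>x\<^sub>2\<^sup>n Q(x\<^sub>1/x\<^sub>2, q\<^sub>1, q\<^sub>2)\<close> where \<open>x\<^sub>2 \<noteq> 0\<close>, with polynomials \<open>P\<close> and \<open>Q\<close>. Comparing the
  two expressions bounds the degree of \<open>P\<close> in its first argument by \<open>n\<close>, so that \<open>f = 0\<close> for \<open>n < 0\<close>,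
  and otherwise \<open>f\<close> is a polynomial in \<open>x\<^sub>1, x\<^sub>2, q\<^sub>1, q\<^sub>2\<close> which can be made homogeneous in \<open>q\<close> by
  inserting powers of \<open>q\<^sub>3 = 1\<close>. Since the torus of \<open>B1\<close> rescales \<open>q\<^sub>3\<close> freely, sections over
  \<open>G1/B1\<close> are determined by their restrictions to \<open>G0\<close>, which introduces powers of \<open>1/q\<^sub>3\<close>. The
  sums are direct because sections of different degrees have different eigenvalues under a suitable
  element of the torus.
\<close>

section \<open>Polynomial functions\<close>

lemma poly_funs_cmult: "f \<in> poly_funs C \<Longrightarrow> (\<lambda>x. c * f x) \<in> poly_funs C"
  by (intro poly_funs.mult poly_funs.const)

lemma poly_funs_power: "f \<in> poly_funs C \<Longrightarrow> (\<lambda>x. f x ^ n) \<in> poly_funs C"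
  by (induction n) (auto intro: poly_funs.intros)

lemma poly_funs_sum:
  "(\<And>i. i \<in> I \<Longrightarrow> f i \<in> poly_funs C) \<Longrightarrow> (\<lambda>x. \<Sum>i\<in>I. f i x) \<in> poly_funs C"
  by (induction I rule: infinite_finite_induct) (auto intro: poly_funs.intros)

lemma poly_funs_compose:
  assumes "f \<in> poly_funs C" and "\<And>h. h \<in> C \<Longrightarrow> (\<lambda>x. h (\<phi> x)) \<in> poly_funs D"
  shows "(\<lambda>x. f (\<phi> x)) \<in> poly_funs D"
  using assms(1) by (induction rule: poly_funs.induct) (auto intro: poly_funs.intros assms(2))

section \<open>Polynomials in one variable with polynomial coefficients\<close>

text \<open>
  No bound on the degree of \<open>c w\<close> uniform in \<open>w\<close> is needed: for sections it follows from the
  comparison of the two charts.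
\<close>

definition poly_family :: "('w \<Rightarrow> complex) set \<Rightarrow> (complex \<Rightarrow> 'w \<Rightarrow> complex) \<Rightarrow> bool" where
  "poly_family D F \<longleftrightarrow>
     (\<exists>c. (\<forall>k. (\<lambda>w. coeff (c w) k) \<in> poly_funs D) \<and> (\<forall>u w. F u w = poly (c w) u))"

lemma poly_family_const:
  assumes "f \<in> poly_funs D"
  shows "poly_family D (\<lambda>_. f)"
proof -
  have "(\<lambda>w. coeff [:f w:] k) \<in> poly_funs D" for k
    by (cases k) (auto intro: assms poly_funs.const)
  then show ?thesis
    unfolding poly_family_def by (intro exI[of _ "\<lambda>w. [:f w:]"]) simp
qed

lemma poly_family_var: "poly_family D (\<lambda>u _. u)"
  unfolding poly_family_def
  by (rule exI[of _ "\<lambda>w. [:0, 1:]"])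
     (auto intro: poly_funs.const)

lemma poly_family_add:
  assumes "poly_family D F" and "poly_family D F'"
  shows "poly_family D (\<lambda>u w. F u w + F' u w)"
proof -
  from assms obtain c c' where
    "\<forall>k. (\<lambda>w. coeff (c w) k) \<in> poly_funs D" "\<forall>u w. F u w = poly (c w) u"
    "\<forall>k. (\<lambda>w. coeff (c' w) k) \<in> poly_funs D" "\<forall>u w. F' u w = poly (c' w) u"
    unfolding poly_family_def by metis
  then show ?thesis
    unfolding poly_family_def
    by (intro exI[of _ "\<lambda>w. c w + c' w"]) (auto intro: poly_funs.add)
qed

lemma poly_family_mult:
  assumes "poly_family D F" and "poly_family D F'"
  shows "poly_family D (\<lambda>u w. F u w * F' u w)"
proof -
  from assms obtain c c' where
    "\<forall>k. (\<lambda>w. coeff (c w) k) \<in> poly_funs D" "\<forall>u w. F u w = poly (c w) u"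
    "\<forall>k. (\<lambda>w. coeff (c' w) k) \<in> poly_funs D" "\<forall>u w. F' u w = poly (c' w) u"
    unfolding poly_family_def by metis
  then show ?thesis
    unfolding poly_family_def
    by (intro exI[of _ "\<lambda>w. c w * c' w"])
       (auto simp: coeff_mult intro!: poly_funs_sum poly_funs.mult)
qed

text \<open>\<open>poly_family D\<close> is closed under sums and products and contains the
  constants, so membership only has to be checked on the coordinate functions.\<close>

lemma poly_family_compose:
  assumes "f \<in> poly_funs C" and "\<And>h. h \<in> C \<Longrightarrow> poly_family D (\<lambda>u w. h (\<phi> u w))"
  shows "poly_family D (\<lambda>u w. f (\<phi> u w))"
  using assms(1)
  by (induction rule: poly_funs.induct)
     (auto intro: poly_family_const poly_family_add poly_family_mult poly_funs.const assms(2))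

text \<open>A family over the one-point type \<open>unit\<close> with no coordinate functions is a
  single polynomial, which makes this the case of \<open>poly_family_compose\<close> without
  parameters.\<close>

lemma poly_along_curve:
  assumes "f \<in> poly_funs C" and "\<And>h. h \<in> C \<Longrightarrow> \<exists>P. \<forall>u. h (\<phi> u) = poly P u"
  obtains P where "\<And>u. f (\<phi> u) = poly P u"
proof -
  have "poly_family {} (\<lambda>u (_::unit). f (\<phi> u))"
  proof (rule poly_family_compose[OF assms(1)])
    fix h assume "h \<in> C"
    then obtain P where "\<forall>u. h (\<phi> u) = poly P u" using assms(2) by blast
    then show "poly_family {} (\<lambda>u (_::unit). h (\<phi> u))"
      unfolding poly_family_def by (intro exI[of _ "\<lambda>_. P"]) (auto intro: poly_funs.const)
  qed
  then show ?thesis unfolding poly_family_def using that by auto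
qed

section \<open>Comparing two charts of the projective line\<close>

lemma poly_eqI_nonzero:
  fixes p q :: "complex poly"
  assumes "\<And>u. u \<noteq> 0 \<Longrightarrow> poly p u = poly q u"
  shows "p = q"
proof (rule ccontr)
  assume "p \<noteq> q"
  then have "finite {u. poly (p - q) u = 0}" by (intro poly_roots_finite) simp
  moreover have "- {0} \<subseteq> {u. poly (p - q) u = 0}" using assms by auto
  ultimately have "finite (- {0::complex})" by (rule finite_subset[rotated])
  then show False using infinite_UNIV_char_0[where 'a=complex]
    by (metis Compl_eq_Diff_UNIV finite_Diff2 finite.emptyI finite.insertI)
qed

text \<open>
  The two functions are a section of the line bundle of degree \<open>n\<close> on the projective line, in
  its two standard charts.
\<close>

lemma line_bundle_P1:
  fixes p q :: "complex poly" and n :: int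
  assumes "\<And>u. u \<noteq> 0 \<Longrightarrow> poly p u = u powi n * poly q (1 / u)"
  shows coeff_line_bundle_P1: "\<And>k. int k > n \<Longrightarrow> coeff p k = 0"
    and poly_line_bundle_P1:
      "\<And>a b. n \<ge> 0 \<Longrightarrow> a \<noteq> 0 \<Longrightarrow>
         a powi n * poly p (b / a) = (\<Sum>k\<le>nat n. coeff p k * a ^ (nat n - k) * b ^ k)"
    and poly_line_bundle_P1':
      "\<And>a b. n \<ge> 0 \<Longrightarrow> b \<noteq> 0 \<Longrightarrow>
         b powi n * poly q (a / b) = (\<Sum>k\<le>nat n. coeff p k * a ^ (nat n - k) * b ^ k)"
proof -
  define m where "m = degree q"
  \<comment> \<open>The positive and negative parts of \<open>n\<close>, with n = j - i, keep all
    exponents natural when denominators are cleared.\<close>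
  define i j where "i = nat (- n)" and "j = nat n"
  have powi: "u ^ i * u powi n = u ^ j" if "u \<noteq> 0" for u :: complex
    using that by (cases "n \<ge> 0") (auto simp: i_def j_def power_int_def simp flip: power_mult_distrib)
  \<comment> \<open>Multiplication by u^(m + i) turns q(1/u) into the reversed polynomial of
    \<open>q\<close>, so the transition rule becomes an identity of polynomials.\<close>
  have "monom 1 (m + i) * p = monom 1 j * reflect_poly q"
  proof (rule poly_eqI_nonzero)
    fix u :: complex assume u: "u \<noteq> 0"
    have "poly (monom 1 (m + i) * p) u = u ^ m * (u ^ i * u powi n) * poly q (inverse u)"
      using assms[OF u] by (simp add: poly_monom power_add inverse_eq_divide)
    also have "\<dots> = poly (monom 1 j * reflect_poly q) u"
      unfolding powi[OF u] using poly_reflect_poly_nz[OF u, of q] by (simp add: poly_monom m_def)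
    finally show "poly (monom 1 (m + i) * p) u = poly (monom 1 j * reflect_poly q) u" .
  qed
  then have eq: "coeff (monom 1 (m + i) * p) k = coeff (monom 1 j * reflect_poly q) k" for k
    by simp
  show hi: "coeff p k = 0" if "int k > n" for k
  proof -
    have "int j = n + int i" by (simp add: i_def j_def)
    \<comment> \<open>The index m + i + k picks out \<open>coeff p k\<close> on the left, while on
      the right it lies beyond the degree of \<open>reflect_poly q\<close>.\<close>
    then have "m + i + k \<ge> j" "m + i + k - j > m" using that by linarith+
    then show ?thesis
      using eq[of "m + i + k"] by (simp add: coeff_monom_mult coeff_reflect_poly m_def)
  qed
  have p_sum: "poly p u = (\<Sum>k\<le>nat n. coeff p k * u ^ k)" if "n \<ge> 0" for u
  proof -
    have "degree p \<le> nat n" using hi that by (intro degree_le) auto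
    then show ?thesis
      unfolding poly_altdef by (intro sum.mono_neutral_left) (auto simp: coeff_eq_0)
  qed
  show A: "a powi n * poly p (b / a) = (\<Sum>k\<le>nat n. coeff p k * a ^ (nat n - k) * b ^ k)"
    if "n \<ge> 0" "a \<noteq> 0" for a b
  proof -
    have "a powi n = a ^ nat n" using that by (simp add: power_int_def)
    then show ?thesis
      unfolding p_sum[OF that(1)] sum_distrib_left using that(2)
      by (intro sum.cong) (auto simp: power_diff power_divide)
  qed
  show "b powi n * poly q (a / b) = (\<Sum>k\<le>nat n. coeff p k * a ^ (nat n - k) * b ^ k)"
    if "n \<ge> 0" "b \<noteq> 0" for a b
  proof -
    \<comment> \<open>The coefficients of \<open>p\<close> reversed with respect to \<open>n\<close>
      instead of the degree of \<open>p\<close>; the transition rule forces \<open>q\<close> to be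
      this polynomial.\<close>
    define r where "r = (\<Sum>k\<le>nat n. monom (coeff p k) (nat n - k))"
    have r: "poly r v = (\<Sum>k\<le>nat n. coeff p k * v ^ (nat n - k))" for v
      by (simp add: r_def poly_sum poly_monom)
    have "q = r"
    proof (rule poly_eqI_nonzero)
      fix v :: complex assume v: "v \<noteq> 0"
      then have "poly p (1 / v) = (1 / v) powi n * poly q v" using assms[of "1 / v"] by simp
      then have "poly q v = v powi n * poly p (1 / v)"
        using v by (simp add: power_int_divide_distrib)
      then show "poly q v = poly r v" using A[OF that(1) v, of 1] by (simp add: r)
    qed
    have "b powi n = b ^ nat n" using that by (simp add: power_int_def)
    moreover have "b ^ nat n = b ^ (nat n - k) * b ^ k" if "k \<le> nat n" for k
      using that by (simp flip: power_add)
    ultimately show ?thesis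
      unfolding \<open>q = r\<close> r sum_distrib_left using that(2)
      by (intro sum.cong) (auto simp: power_divide)
  qed
qed

section \<open>The coordinates on the quotients\<close>

definition mat_of_cols :: "complex^3 \<Rightarrow> complex^3 \<Rightarrow> complex^3 \<Rightarrow> mat3" where
  "mat_of_cols x y z = (\<chi> i. vector [x$i, y$i, z$i])"

lemma mat_of_cols_nth [simp]:
  "mat_of_cols x y z $ i $ 1 = x $ i"
  "mat_of_cols x y z $ i $ 2 = y $ i"
  "mat_of_cols x y z $ i $ 3 = z $ i"
  by (simp_all add: mat_of_cols_def)

lemmas mat3_simps = matrix_matrix_mult_def sum_3 det_3 vec_eq_iff forall_3

lemma mat3_mult_nth:
  fixes A A' :: mat3
  shows "(A ** A') $ i $ j = A$i$1 * A'$1$j + A$i$2 * A'$2$j + A$i$3 * A'$3$j"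
  by (simp add: matrix_matrix_mult_def sum_3)

lemma fst_pq_of [simp]: "fst (pq_of g) $ i = g $ i $ 1"
  by (simp add: pq_of_def column_def Let_def)

lemma snd_pq_of [simp]:
  "snd (pq_of g) $ 1 = g$2$1 * g$3$2 - g$3$1 * g$2$2"
  "snd (pq_of g) $ 2 = g$3$1 * g$1$2 - g$1$1 * g$3$2"
  "snd (pq_of g) $ 3 = g$1$1 * g$2$2 - g$2$1 * g$1$2"
  by (simp_all add: pq_of_def column_def Let_def)

lemma q3_pq_of: "q3 (pq_of g) = g$1$1 * g$2$2 - g$2$1 * g$1$2"
  by (simp add: q3_def)

text \<open>Expansion of the determinant along the last column, whose only nonzero entry is the
  third.\<close>

lemma q3_G1: "g \<in> G1 \<Longrightarrow> q3 (pq_of g) * g$3$3 = 1"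
  by (auto simp: G1_def G_def det_3 q3_pq_of algebra_simps)

lemma q3_G1_nonzero: "g \<in> G1 \<Longrightarrow> q3 (pq_of g) \<noteq> 0"
  using q3_G1 by force

lemma q3_G1_inverse: "g \<in> G1 \<Longrightarrow> g$3$3 = 1 / q3 (pq_of g)"
  using q3_G1 q3_G1_nonzero by (simp add: field_simps)

lemma q3_G0: "g \<in> G0 \<Longrightarrow> q3 (pq_of g) = 1"
  by (auto simp: G0_def G_def det_3 q3_pq_of algebra_simps)

lemma G0_subset_G1: "G0 \<subseteq> G1" and G1_subset_G: "G1 \<subseteq> G"
  by (auto simp: G0_def G1_def)

lemma p_dot_q_pq_of: "p_dot_q (pq_of g) = 0"
  by (simp add: p_dot_q_def sum_3 algebra_simps)

lemma pq_of_in_GU: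
  assumes "g \<in> G"
  shows "pq_of g \<in> GU"
proof -
  \<comment> \<open>Expansion along the third column gives q.z = 1, which rules out q = 0. It also
    rules out p = 0, since q is bilinear in the first two columns.\<close>
  have det: "snd (pq_of g) $ 1 * g$1$3 + snd (pq_of g) $ 2 * g$2$3 + snd (pq_of g) $ 3 * g$3$3 = 1"
    using assms by (simp add: G_def det_3 algebra_simps)
  have "snd (pq_of g) \<noteq> 0"
  proof
    assume "snd (pq_of g) = 0"
    then show False using det by (simp only: zero_index) simp
  qed
  moreover have "fst (pq_of g) \<noteq> 0"
  proof
    assume "fst (pq_of g) = 0"
    then have "g$i$1 = 0" for i using fst_pq_of[of g i] by simp
    then show False using det by simp
  qed
  ultimately show ?thesis by (simp add: GU_def p_dot_q_pq_of)
qed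

lemma pq_of_in_G1U1: "g \<in> G1 \<Longrightarrow> pq_of g \<in> G1U1"
  using pq_of_in_GU[of g] G1_subset_G q3_G1_nonzero by (auto simp: GU_def G1U1_def)

lemma pq_of_in_G0U0: "g \<in> G0 \<Longrightarrow> pq_of g \<in> G0U0"
  using pq_of_in_GU[of g] G1_subset_G G0_subset_G1 q3_G0 by (auto simp: GU_def G0U0_def)

lemma pq_of_surj_G1:
  assumes "w \<in> G1U1"
  obtains g where "g \<in> G1" and "pq_of g = w"
proof -
  obtain p q where w: "w = (p, q)" by (cases w)
  have q: "q$3 \<noteq> 0" and pq: "p$1 * q$1 + p$2 * q$2 + p$3 * q$3 = 0" and p: "p \<noteq> 0"
    using assms by (auto simp: w G1U1_def q3_def p_dot_q_def sum_3)
  \<comment> \<open>If p1 = p2 = 0, the relation p.q = 0 reduces to p3 q3 = 0 and forces p =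
    0.\<close>
  have "p$1 \<noteq> 0 \<or> p$2 \<noteq> 0"
    using p q pq by (auto simp: vec_eq_iff forall_3)
  then show thesis
  proof
    assume p1: "p$1 \<noteq> 0"
    \<comment> \<open>The second column solves x \<times> y = q. Solutions exist because p.q = 0 and
      differ by multiples of p, so y1 = 0 can be imposed when p1 is nonzero. The last entry makes
      the determinant 1.\<close>
    let ?g = "mat_of_cols p (vector [0, q$3 / p$1, - q$2 / p$1]) (vector [0, 0, 1 / q$3])"
    have "?g \<in> G1" using p1 q by (simp add: G1_def G_def det_3)
    moreover have "pq_of ?g = w"
      using p1 q pq by (simp add: w prod_eq_iff mat3_simps field_simps) algebra
    ultimately show thesis by (rule that)
  next
    assume p2: "p$2 \<noteq> 0"
    \<comment> \<open>Here the solution is normalised by y2 = 0.\<close>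
    let ?g = "mat_of_cols p (vector [- q$3 / p$2, 0, q$1 / p$2]) (vector [0, 0, 1 / q$3])"
    have "?g \<in> G1" using p2 q by (simp add: G1_def G_def det_3)
    moreover have "pq_of ?g = w"
      using p2 q pq by (simp add: w prod_eq_iff mat3_simps field_simps) algebra
    ultimately show thesis by (rule that)
  qed
qed

lemma pq_of_surj_G0:
  assumes "w \<in> G0U0"
  obtains g where "g \<in> G0" and "pq_of g = w"
proof -
  from assms have w: "w \<in> G1U1" "q3 w = 1" by (auto simp: G0U0_def G1U1_def)
  from w(1) obtain g where "g \<in> G1" "pq_of g = w" by (rule pq_of_surj_G1)
  moreover from this have "g \<in> G0"
    using q3_G1[of g] w(2) by (simp add: G0_def G1_def)
  ultimately show thesis using that by blast
qed

section \<open>Right multiplication by the Borel subgroups\<close>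

lemma G_mult: "g \<in> G \<Longrightarrow> b \<in> G \<Longrightarrow> g ** b \<in> G"
  by (simp add: G_def det_mul)

lemma G1_mult: "g \<in> G1 \<Longrightarrow> b \<in> B1 \<Longrightarrow> g ** b \<in> G1"
  using G_mult[of g b] by (auto simp: G1_def B1_def B_def matrix_matrix_mult_def sum_3)

lemma G0_mult: "g \<in> G0 \<Longrightarrow> b \<in> B0 \<Longrightarrow> g ** b \<in> G0"
  using G_mult[of g b] by (auto simp: G0_def B0_def B_def matrix_matrix_mult_def sum_3)

lemma B_diagonal: "b \<in> B \<Longrightarrow> b$1$1 * b$2$2 * b$3$3 = 1"
  by (auto simp: B_def G_def det_3)

lemma B_diagonal_nonzero:
  assumes "b \<in> B"
  shows "b$1$1 \<noteq> 0" and "b$3$3 \<noteq> 0" and "b$1$1 * b$2$2 = inverse (b$3$3)"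
proof -
  show "b$1$1 \<noteq> 0" "b$3$3 \<noteq> 0" using B_diagonal[OF assms] by auto
  show "b$1$1 * b$2$2 = inverse (b$3$3)"
    using B_diagonal[OF assms] by (intro inverse_unique[symmetric]) (simp add: mult.commute)
qed

text \<open>The multiple of x that \<open>b\<close> adds to y drops out of the cross product,
  leaving the factor \<open>b$1$1 * b$2$2\<close>, which is the inverse of
  \<open>b$3$3\<close>.\<close>

lemma pq_of_mult_B:
  assumes "b \<in> B"
  shows "pq_of (g ** b) = (b$1$1 *s fst (pq_of g), inverse (b$3$3) *s snd (pq_of g))"
  using assms unfolding B_diagonal_nonzero(3)[OF assms, symmetric]
  by (simp add: prod_eq_iff mat3_simps B_def algebra_simps)

text \<open>Homogeneity is expressed through scaling, because members of \<open>poly_funs\<close>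
  are functions and carry no degree.\<close>

definition bihom :: "nat \<Rightarrow> nat \<Rightarrow> (pq \<Rightarrow> complex) set" where
  "bihom a d = {F \<in> poly_funs pq_coords.
     \<forall>\<alpha> \<beta> w. F (\<alpha> *s fst w, \<beta> *s snd w) = \<alpha> ^ a * \<beta> ^ d * F w}"

lemma bihom_poly: "F \<in> bihom a d \<Longrightarrow> F \<in> poly_funs pq_coords"
  by (simp add: bihom_def)

lemma bihom_scale: "F \<in> bihom a d \<Longrightarrow> F (\<alpha> *s fst w, \<beta> *s snd w) = \<alpha> ^ a * \<beta> ^ d * F w"
  unfolding bihom_def by blast

lemma bihom_mult:
  "F \<in> bihom a d \<Longrightarrow> F' \<in> bihom a' d' \<Longrightarrow> (\<lambda>w. F w * F' w) \<in> bihom (a + a') (d + d')"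
  by (auto simp: bihom_def power_add intro: poly_funs.mult)

lemma bihom_add: "F \<in> bihom a d \<Longrightarrow> F' \<in> bihom a d \<Longrightarrow> (\<lambda>w. F w + F' w) \<in> bihom a d"
  by (auto simp: bihom_def algebra_simps intro: poly_funs.add)

lemma bihom_cmult: "F \<in> bihom a d \<Longrightarrow> (\<lambda>w. c * F w) \<in> bihom a d"
  by (auto simp: bihom_def intro: poly_funs_cmult)

lemma bihom_sum:
  "(\<And>i. i \<in> I \<Longrightarrow> F i \<in> bihom a d) \<Longrightarrow> (\<lambda>w. \<Sum>i\<in>I. F i w) \<in> bihom a d"
  by (auto simp: bihom_def sum_distrib_left intro: poly_funs_sum)

lemma bihom_const: "(\<lambda>_. c) \<in> bihom 0 0"
  by (auto simp: bihom_def intro: poly_funs.const)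

lemma bihom_p: "(\<lambda>w. fst w $ i) \<in> bihom 1 0"
  by (auto simp: bihom_def pq_coords_def intro: poly_funs.coord)

lemma bihom_q: "(\<lambda>w. snd w $ i) \<in> bihom 0 1"
  by (auto simp: bihom_def pq_coords_def intro: poly_funs.coord)

lemma bihom_power: "F \<in> bihom a d \<Longrightarrow> (\<lambda>w. F w ^ n) \<in> bihom (n * a) (n * d)"
  by (induction n) (auto intro: bihom_mult bihom_const[of 1])

lemma bihom_q3_power: "(\<lambda>w. q3 w ^ n) \<in> bihom 0 n"
  using bihom_power[OF bihom_q[of 3], of n] by (simp add: q3_def)

text \<open>Factors of \<open>q3\<close> raise the degree without changing values where
  \<open>q3\<close> is 1. Asking for every large \<open>d\<close>, not just one, lets summands be
  brought to a common degree. The coordinates \<open>fst\<close> and \<open>snd\<close> stand for q1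
  and q2.\<close>

lemma homogenise:
  assumes "c \<in> poly_funs {fst, snd}"
  shows "\<exists>d0. \<forall>d\<ge>d0. \<exists>F\<in>bihom 0 d. \<forall>w. q3 w = 1 \<longrightarrow> F w = c (snd w $ 1, snd w $ 2)"
  using assms
proof (induction rule: poly_funs.induct)
  case (const c)
  have "\<exists>F\<in>bihom 0 d. \<forall>w. q3 w = 1 \<longrightarrow> F w = c" for d
    by (rule bexI[of _ "\<lambda>w. c * q3 w ^ d"]) (simp_all add: bihom_cmult bihom_q3_power)
  then show ?case by blast
next
  case (coord f)
  then obtain i where f: "\<And>w::pq. f (snd w $ 1, snd w $ 2) = snd w $ i" by fastforce
  have "\<exists>F\<in>bihom 0 d. \<forall>w. q3 w = 1 \<longrightarrow> F w = snd w $ i" if "d \<ge> 1" for d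
    using bihom_mult[OF bihom_q[of i] bihom_q3_power[of "d - 1"]] that
    by (intro bexI[of _ "\<lambda>w. snd w $ i * q3 w ^ (d - 1)"]) simp_all
  then show ?case unfolding f by blast
next
  case (add f g)
  then obtain d1 d2 where
    "\<forall>d\<ge>d1. \<exists>F\<in>bihom 0 d. \<forall>w. q3 w = 1 \<longrightarrow> F w = f (snd w $ 1, snd w $ 2)"
    "\<forall>d\<ge>d2. \<exists>F\<in>bihom 0 d. \<forall>w. q3 w = 1 \<longrightarrow> F w = g (snd w $ 1, snd w $ 2)" by blast
  then show ?case
    by (intro exI[of _ "max d1 d2"]) (metis (no_types, lifting) bihom_add max.bounded_iff)
next
  case (mult f g)
  then obtain d1 d2 where
    1: "\<forall>d\<ge>d1. \<exists>F\<in>bihom 0 d. \<forall>w. q3 w = 1 \<longrightarrow> F w = f (snd w $ 1, snd w $ 2)" and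
    2: "\<forall>d\<ge>d2. \<exists>F\<in>bihom 0 d. \<forall>w. q3 w = 1 \<longrightarrow> F w = g (snd w $ 1, snd w $ 2)" by blast
  show ?case
  proof (intro exI[of _ "d1 + d2"] allI impI)
    fix d assume "d \<ge> d1 + d2"
    then have "d2 \<le> d - d1" and d: "d1 + (d - d1) = d" by simp_all
    with 1 2 obtain F F' where F: "F \<in> bihom 0 d1" "F' \<in> bihom 0 (d - d1)"
      "\<And>w. q3 w = 1 \<Longrightarrow> F w = f (snd w $ 1, snd w $ 2)"
      "\<And>w. q3 w = 1 \<Longrightarrow> F' w = g (snd w $ 1, snd w $ 2)" by blast
    with bihom_mult[OF F(1,2)]
    show "\<exists>F\<in>bihom 0 d. \<forall>w. q3 w = 1 \<longrightarrow>
        F w = f (snd w $ 1, snd w $ 2) * g (snd w $ 1, snd w $ 2)"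
      unfolding d by (intro bexI[of _ "\<lambda>w. F w * F' w"]) auto
  qed
qed

section \<open>Sections over the homogeneous spaces\<close>

lemma on_set_apply: "x \<in> X \<Longrightarrow> on_set X f x = f x"
  and on_set_outside: "x \<notin> X \<Longrightarrow> on_set X f x = 0"
  by (simp_all add: on_set_def)

lemma on_set_eq_self_iff: "on_set X f = f \<longleftrightarrow> (\<forall>x. x \<notin> X \<longrightarrow> f x = 0)"
  by (auto simp: on_set_def fun_eq_iff)

lemma on_set_eqI: "(\<And>x. x \<in> X \<Longrightarrow> f x = g x) \<Longrightarrow> on_set X f = on_set X g"
  by (auto simp: on_set_def fun_eq_iff)

lemma on_set_on_set: "Y \<subseteq> X \<Longrightarrow> on_set Y (on_set X f) = on_set Y f"
  by (auto simp: on_set_def fun_eq_iff)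

lemma regular_funs_outside: "f \<in> regular_funs C X \<Longrightarrow> x \<notin> X \<Longrightarrow> f x = 0"
  by (auto simp: regular_funs_def on_set_def)

lemma subspace_regular_funs: "fun_space.subspace (regular_funs C X)"
proof (rule fun_space.subspaceI)
  show "0 \<in> regular_funs C X"
    unfolding regular_funs_def
    by (rule image_eqI[OF _ poly_funs.const[of 0]]) (simp add: on_set_def fun_eq_iff)
next
  fix f g assume "f \<in> regular_funs C X" "g \<in> regular_funs C X"
  then obtain F F' where "F \<in> poly_funs C" "F' \<in> poly_funs C" "f = on_set X F" "g = on_set X F'"
    by (auto simp: regular_funs_def)
  then show "f + g \<in> regular_funs C X"
    unfolding regular_funs_def
    by (intro image_eqI[OF _ poly_funs.add[of F C F']]) (auto simp: on_set_def fun_eq_iff)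
next
  fix c f assume "f \<in> regular_funs C X"
  then obtain F where "F \<in> poly_funs C" "f = on_set X F"
    by (auto simp: regular_funs_def)
  then show "fscale c f \<in> regular_funs C X"
    unfolding regular_funs_def
    by (intro image_eqI[OF _ poly_funs_cmult[of F C c]]) (auto simp: on_set_def fscale_def fun_eq_iff)
qed

lemma subspace_H0: "fun_space.subspace (H0 H K ch)"
proof -
  have "fun_space.subspace
      {f. \<forall>g\<in>H. \<forall>b\<in>K. f (g ** b) = inverse (ch b) * f g}"
    by (rule fun_space.subspaceI) (auto simp: fscale_def algebra_simps)
  moreover have "H0 H K ch = regular_funs mat_coords H \<inter>
      {f. \<forall>g\<in>H. \<forall>b\<in>K. f (g ** b) = inverse (ch b) * f g}"
    by (auto simp: H0_def)
  ultimately show ?thesis by (simp add: fun_space.subspace_inter subspace_regular_funs)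
qed

lemma H0_outside: "f \<in> H0 H K ch \<Longrightarrow> g \<notin> H \<Longrightarrow> f g = 0"
  by (auto simp: H0_def regular_funs_outside)

lemma H0_eq_pullback:
  assumes "f \<in> H0 H K ch" and "\<And>g. g \<in> H \<Longrightarrow> f g = F (pq_of g)"
  shows "f = pullback H F"
  using assms H0_outside[OF assms(1)] by (auto simp: pullback_def on_set_def fun_eq_iff)

lemma H0_equivariant: "f \<in> H0 H K ch \<Longrightarrow> g \<in> H \<Longrightarrow> b \<in> K \<Longrightarrow> f (g ** b) = inverse (ch b) * f g"
  by (simp add: H0_def)

text \<open>Closure of \<open>H'\<close> under \<open>K'\<close> keeps \<open>g ** b\<close> where
  the extension by zero still agrees with \<open>f\<close>, so equivariance survives the
  restriction.\<close>

lemma H0_restrict: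
  assumes "f \<in> H0 H K ch" "H' \<subseteq> H" "K' \<subseteq> K" "\<And>g b. g \<in> H' \<Longrightarrow> b \<in> K' \<Longrightarrow> g ** b \<in> H'"
    and "\<And>b. b \<in> K' \<Longrightarrow> ch b = ch' b"
  shows "on_set H' f \<in> H0 H' K' ch'"
proof -
  obtain F where "F \<in> poly_funs mat_coords" "f = on_set H F"
    using assms(1) by (auto simp: H0_def regular_funs_def)
  then have "on_set H' f \<in> regular_funs mat_coords H'"
    using assms(2) by (auto simp: on_set_on_set regular_funs_def)
  then show ?thesis
    using assms H0_equivariant[OF assms(1)] by (auto simp: H0_def on_set_def subset_iff)
qed

text \<open>On \<open>B0\<close> the entry \<open>b$3$3\<close> is 1, hence the second weight
  \<open>m\<close> is arbitrary in the comparison with \<open>chi0\<close>.\<close>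

lemma inverse_chi: "inverse (chi n m b) = b$1$1 powi n * inverse (b$3$3) powi m"
  and chi1_eq_chi: "chi1 n m = chi n m"
  and chi0_eq_chi: "b \<in> B0 \<Longrightarrow> chi0 n b = chi n m b"
  by (auto simp: chi_def chi1_def chi0_def power_int_minus power_int_inverse fun_eq_iff
      B0_def G0_def)

lemma mat_coord: "(\<lambda>g. g $ i $ j) \<in> poly_funs mat_coords"
  by (intro poly_funs.coord) (auto simp: mat_coords_def)

lemma poly_pq_of:
  assumes "F \<in> poly_funs pq_coords"
  shows "(\<lambda>g. F (pq_of g)) \<in> poly_funs mat_coords"
proof (rule poly_funs_compose[OF assms])
  have diff: "(\<lambda>g. f g - f' g) \<in> poly_funs mat_coords"
    if "f \<in> poly_funs mat_coords" "f' \<in> poly_funs mat_coords" for f f'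
    using poly_funs.add[OF that(1) poly_funs_cmult[OF that(2), of "- 1"]] by simp
  have "(\<lambda>g. snd (pq_of g) $ i) \<in> poly_funs mat_coords" for i
    using exhaust_3[of i] by (auto intro!: diff poly_funs.mult mat_coord)
  then show "(\<lambda>g. h (pq_of g)) \<in> poly_funs mat_coords" if "h \<in> pq_coords" for h
    using that by (auto simp: pq_coords_def intro: mat_coord)
qed

lemma bihom_mult_B:
  assumes "F \<in> bihom a d" and "b \<in> B"
  shows "F (pq_of (g ** b)) = b$1$1 ^ a * inverse (b$3$3) ^ d * F (pq_of g)"
  unfolding pq_of_mult_B[OF assms(2)] by (rule bihom_scale[OF assms(1)])

lemma bihom_pullback_G:
  assumes "F \<in> bihom a d"
  shows "pullback G F \<in> H0 G B (chi (int a) (int d))"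
proof -
  have "pullback G F \<in> regular_funs mat_coords G"
    unfolding pullback_def regular_funs_def comp_def using poly_pq_of[OF bihom_poly[OF assms]] by blast
  then show ?thesis
    using bihom_mult_B[OF assms] G_mult
    by (auto simp: H0_def pullback_def on_set_def inverse_chi B_def)
qed

text \<open>Cutting off outside \<open>GU\<close> does not affect the pullback, as
  \<open>pq_of\<close> maps \<open>G\<close> into \<open>GU\<close>.\<close>

lemma bihom_H0_GB_pq:
  assumes "F \<in> bihom a d"
  shows "on_set GU F \<in> H0_GB_pq (int a) (int d)"
proof -
  have "pullback G (on_set GU F) = pullback G F"
    unfolding pullback_def using pq_of_in_GU by (intro on_set_eqI) (simp add: on_set_apply)
  then show ?thesis
    using bihom_pullback_G[OF assms] by (simp add: H0_GB_pq_def on_set_on_set)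
qed

lemma pullback_restrict:
  assumes "H' \<subseteq> H"
  shows "pullback H' F = on_set H' (pullback H F)"
  using assms by (simp add: pullback_def on_set_on_set)

text \<open>On \<open>G1\<close> the function \<open>1/q\<^sub>3\<close> is regular, being the matrix entry \<open>z\<^sub>3\<close>.\<close>

lemma pullback_G1_divide_q3:
  assumes "pullback G F \<in> H0 G B (chi n (int l + m))"
  shows "pullback G1 (\<lambda>w. 1 / q3 w ^ l * F w) \<in> H0 G1 B1 (chi1 n m)"
proof -
  have "on_set G1 (pullback G F) \<in> H0 G1 B1 (chi n (int l + m))"
    by (intro H0_restrict[OF assms G1_subset_G] G1_mult) (auto simp: B1_def)
  then have F: "pullback G1 F \<in> H0 G1 B1 (chi n (int l + m))"
    by (simp flip: pullback_restrict[OF G1_subset_G])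
  have eq: "pullback G1 (\<lambda>w. 1 / q3 w ^ l * F w) = on_set G1 (\<lambda>g. g$3$3 ^ l * pullback G1 F g)"
    unfolding pullback_def
    by (intro on_set_eqI) (simp add: on_set_def q3_G1_inverse power_divide)
  obtain P where P: "P \<in> poly_funs mat_coords" "pullback G1 F = on_set G1 P"
    using F by (auto simp: H0_def regular_funs_def)
  have "on_set G1 (\<lambda>g. g$3$3 ^ l * pullback G1 F g) = on_set G1 (\<lambda>g. g$3$3 ^ l * P g)"
    unfolding P by (intro on_set_eqI) (simp add: on_set_apply)
  moreover have "(\<lambda>g. g$3$3 ^ l * P g) \<in> poly_funs mat_coords"
    by (intro poly_funs.mult poly_funs_power mat_coord P)
  ultimately have "on_set G1 (\<lambda>g. g$3$3 ^ l * pullback G1 F g) \<in> regular_funs mat_coords G1"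
    by (auto simp: regular_funs_def)
  moreover have "on_set G1 (\<lambda>g. g$3$3 ^ l * pullback G1 F g) (g ** b) =
      inverse (chi1 n m b) * on_set G1 (\<lambda>g. g$3$3 ^ l * pullback G1 F g) g"
    if "g \<in> G1" "b \<in> B1" for g b
  proof -
    have b: "b \<in> B" "b$3$3 \<noteq> 0" using that B_diagonal_nonzero by (auto simp: B1_def)
    have "(g ** b)$3$3 = g$3$3 * b$3$3"
      using that by (simp add: mat3_simps B1_def B_def G1_def)
    moreover have "chi n (int l + m) b = b$3$3 ^ l * chi n m b"
      using b(2) by (simp add: chi_def power_int_add)
    ultimately show ?thesis
      using that b G1_mult[OF that] H0_equivariant[OF F that]
      by (simp add: on_set_def chi1_eq_chi power_mult_distrib)
  qed
  ultimately show ?thesis unfolding eq by (simp add: H0_def)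
qed

lemma pullback_G0:
  assumes "pullback G F \<in> H0 G B (chi n m)"
  shows "pullback G0 F \<in> H0 G0 B0 (chi0 n)"
proof -
  have "on_set G0 (pullback G F) \<in> H0 G0 B0 (chi0 n)"
    using G0_subset_G1 G1_subset_G chi0_eq_chi
    by (intro H0_restrict[OF assms] G0_mult) (auto simp: B0_def)
  then show ?thesis
    using G0_subset_G1 G1_subset_G by (subst pullback_restrict[of _ G]) auto
qed

section \<open>The two charts of G0/B0\<close>

text \<open>
  Representatives of the points of \<open>G0/B0\<close> with \<open>x\<^sub>1 \<noteq> 0\<close>, resp. \<open>x\<^sub>2 \<noteq> 0\<close>, normalised to
  \<open>x\<^sub>1 = 1\<close>, resp. \<open>x\<^sub>2 = 1\<close>. Here \<open>w = (q\<^sub>1, q\<^sub>2)\<close> and \<open>q\<^sub>3 = 1\<close>.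
\<close>

definition chart1 :: "complex \<Rightarrow> complex \<times> complex \<Rightarrow> mat3" where
  "chart1 u w = mat_of_cols (vector [1, u, - (fst w + u * snd w)]) (vector [0, 1, - snd w])
     (vector [0, 0, 1])"

definition chart2 :: "complex \<Rightarrow> complex \<times> complex \<Rightarrow> mat3" where
  "chart2 v w = mat_of_cols (vector [v, 1, - (v * fst w + snd w)]) (vector [- 1, 0, fst w])
     (vector [0, 0, 1])"

lemma chart1_G0: "chart1 u w \<in> G0" and chart2_G0: "chart2 v w \<in> G0"
  by (simp_all add: chart1_def chart2_def G0_def G_def det_3)

text \<open>The third entry of the first column is the one dictated by p.q = 0 when p1 = 1, p2 = u
  and q3 = 1.\<close>

lemma pq_of_chart1:
  "fst (pq_of (chart1 u w)) = vector [1, u, - (fst w + u * snd w)]"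
  "snd (pq_of (chart1 u w)) = vector [fst w, snd w, 1]"
  by (simp_all add: vec_eq_iff forall_3 chart1_def)

lemma G0_entries:
  assumes "g \<in> G0"
  shows "g$1$3 = 0" "g$2$3 = 0" "g$3$3 = 1" "g$1$1 * g$2$2 - g$2$1 * g$1$2 = 1"
  using assms q3_G0[OF assms] by (auto simp: G0_def q3_pq_of)

text \<open>A matrix of \<open>G0\<close> with x1 nonzero is its chart representative times an
  element of \<open>B0\<close> with first diagonal entry x1, whose character yields the factor
  x1^n.\<close>

lemma H0_G0_chart1:
  assumes f: "f \<in> H0 G0 B0 (chi0 n)" and g: "g \<in> G0" and "g$1$1 \<noteq> 0"
  shows "f g = g$1$1 powi n * f (chart1 (g$2$1 / g$1$1) (snd (pq_of g) $ 1, snd (pq_of g) $ 2))"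
proof -
  define c where "c = chart1 (g$2$1 / g$1$1) (snd (pq_of g) $ 1, snd (pq_of g) $ 2)"
  define b :: mat3 where
    "b = mat_of_cols (vector [g$1$1, 0, 0]) (vector [g$1$2, 1 / g$1$1, 0]) (vector [0, 0, 1])"
  note e = G0_entries[OF g]
  have b: "b \<in> B0" using assms(3) by (simp add: b_def B0_def B_def G0_def G_def det_3)
  \<comment> \<open>Naming the inverse makes the entries of \<open>c ** b = g\<close> polynomial
    identities modulo x1 r = 1 and the determinant relation.\<close>
  define r where "r = inverse (g$1$1)"
  have r: "g$1$1 * r = 1" using assms(3) by (simp add: r_def)
  have "c ** b = g"
    unfolding c_def chart1_def b_def divide_inverse r_def[symmetric]
    by (simp only: vec_eq_iff forall_3 mat3_mult_nth mat_of_cols_nth vector_3 snd_pq_of prod.sel,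
        intro conjI; ((simp add: e(1-3); fail) | (use r e(4) in algebra)))
  then have "f g = inverse (chi0 n b) * f c"
    using H0_equivariant[OF f _ b, of c] chart1_G0 by (simp add: c_def)
  then show ?thesis by (simp add: c_def b_def chi0_def power_int_minus)
qed

lemma H0_G0_chart2:
  assumes f: "f \<in> H0 G0 B0 (chi0 n)" and g: "g \<in> G0" and "g$2$1 \<noteq> 0"
  shows "f g = g$2$1 powi n * f (chart2 (g$1$1 / g$2$1) (snd (pq_of g) $ 1, snd (pq_of g) $ 2))"
proof -
  define c where "c = chart2 (g$1$1 / g$2$1) (snd (pq_of g) $ 1, snd (pq_of g) $ 2)"
  \<comment> \<open>The second row of \<open>c\<close> is (1, 0, 0), so the first row of
    \<open>b\<close> has to be the second row of \<open>g\<close>.\<close>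
  define b :: mat3 where
    "b = mat_of_cols (vector [g$2$1, 0, 0]) (vector [g$2$2, 1 / g$2$1, 0]) (vector [0, 0, 1])"
  note e = G0_entries[OF g]
  have b: "b \<in> B0" using assms(3) by (simp add: b_def B0_def B_def G0_def G_def det_3)
  define r where "r = inverse (g$2$1)"
  have r: "g$2$1 * r = 1" using assms(3) by (simp add: r_def)
  have "c ** b = g"
    unfolding c_def chart2_def b_def divide_inverse r_def[symmetric]
    by (simp only: vec_eq_iff forall_3 mat3_mult_nth mat_of_cols_nth vector_3 snd_pq_of prod.sel,
        intro conjI; ((simp add: e(1-3); fail) | (use r e(4) in algebra)))
  then have "f g = inverse (chi0 n b) * f c"
    using H0_equivariant[OF f _ b, of c] chart2_G0 by (simp add: c_def)
  then show ?thesis by (simp add: c_def b_def chi0_def power_int_minus)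
qed

lemma poly_family_chart:
  assumes "f \<in> regular_funs mat_coords G0"
  shows "poly_family {fst, snd} (\<lambda>u w. f (chart1 u w))"
    and "poly_family {fst, snd} (\<lambda>v w. f (chart2 v w))"
proof -
  obtain P where P: "P \<in> poly_funs mat_coords" "f = on_set G0 P"
    using assms by (auto simp: regular_funs_def)
  note intros = poly_family_var poly_family_add poly_family_mult
    poly_family_const[OF poly_funs.const] poly_family_const[OF poly_funs.coord]
  have neg: "poly_family D (\<lambda>u w. - F u w)" if "poly_family D F" for D and F :: "_ \<Rightarrow> 'x \<Rightarrow> _"
    using poly_family_mult[OF poly_family_const[OF poly_funs.const[of "- 1"]] that] by simp
  have "poly_family {fst, snd} (\<lambda>u w. P (chart1 u w))"
  proof (rule poly_family_compose[OF P(1)])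
    have "poly_family {fst, snd} (\<lambda>u w. chart1 u w $ i $ j)" for i j
      using exhaust_3[of i] exhaust_3[of j]
      by (auto simp: chart1_def simp del: minus_add_distrib intro!: intros neg)
    then show "poly_family {fst, snd} (\<lambda>u w. h (chart1 u w))" if "h \<in> mat_coords" for h
      using that by (auto simp: mat_coords_def)
  qed
  then show "poly_family {fst, snd} (\<lambda>u w. f (chart1 u w))"
    by (simp add: P on_set_apply chart1_G0)
  have "poly_family {fst, snd} (\<lambda>u w. P (chart2 u w))"
  proof (rule poly_family_compose[OF P(1)])
    have "poly_family {fst, snd} (\<lambda>u w. chart2 u w $ i $ j)" for i j
      using exhaust_3[of i] exhaust_3[of j]
      by (auto simp: chart2_def simp del: minus_add_distrib intro!: intros neg)
    then show "poly_family {fst, snd} (\<lambda>u w. h (chart2 u w))" if "h \<in> mat_coords" for h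
      using that by (auto simp: mat_coords_def)
  qed
  then show "poly_family {fst, snd} (\<lambda>v w. f (chart2 v w))"
    by (simp add: P on_set_apply chart2_G0)
qed

text \<open>For fixed q1 and q2 the two chart expressions form a section of degree \<open>n\<close>
  on the projective line. The resulting formula covers both charts at once, with coefficients
  polynomial in q1 and q2.\<close>

lemma H0_G0_coefficients:
  assumes f: "f \<in> H0 G0 B0 (chi0 n)"
  obtains c where "\<And>k. (\<lambda>w. coeff (c w) k) \<in> poly_funs {fst, snd}"
    and "\<And>g. g \<in> G0 \<Longrightarrow> n \<ge> 0 \<Longrightarrow> f g =
      (\<Sum>k\<le>nat n. coeff (c (snd (pq_of g) $ 1, snd (pq_of g) $ 2)) k * g$1$1 ^ (nat n - k) * g$2$1 ^ k)"
    and "\<And>g. g \<in> G0 \<Longrightarrow> n < 0 \<Longrightarrow> f g = 0"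
proof -
  have reg: "f \<in> regular_funs mat_coords G0" using f by (simp add: H0_def)
  obtain c where c: "\<And>k. (\<lambda>w. coeff (c w) k) \<in> poly_funs {fst, snd}"
      "\<And>u w. f (chart1 u w) = poly (c w) u"
    using poly_family_chart(1)[OF reg] by (auto simp: poly_family_def)
  obtain c' where c': "\<And>v w. f (chart2 v w) = poly (c' w) v"
    using poly_family_chart(2)[OF reg] by (auto simp: poly_family_def)
  \<comment> \<open>For nonzero \<open>u\<close> the matrix \<open>chart1 u w\<close> has x2 = u, so
    it also lies in the second chart, with parameter 1/u.\<close>
  have overlap: "poly (c w) u = u powi n * poly (c' w) (1 / u)" if "u \<noteq> 0" for u w
    using H0_G0_chart2[OF f chart1_G0, of u w] that
    by (simp add: c(2) c' pq_of_chart1 del: snd_pq_of) (simp add: chart1_def)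
  show thesis
  proof (rule that[OF c(1)])
    fix g assume g: "g \<in> G0"
    define w where "w = (snd (pq_of g) $ 1, snd (pq_of g) $ 2)"
    have nz: "g$1$1 \<noteq> 0 \<or> g$2$1 \<noteq> 0" using G0_entries(4)[OF g] by auto
    have 1: "f g = g$1$1 powi n * poly (c w) (g$2$1 / g$1$1)" if "g$1$1 \<noteq> 0"
      using H0_G0_chart1[OF f g that] by (simp only: c(2) w_def)
    have 2: "f g = g$2$1 powi n * poly (c' w) (g$1$1 / g$2$1)" if "g$2$1 \<noteq> 0"
      using H0_G0_chart2[OF f g that] by (simp only: c' w_def)
    show "f g = (\<Sum>k\<le>nat n. coeff (c (snd (pq_of g) $ 1, snd (pq_of g) $ 2)) k
        * g$1$1 ^ (nat n - k) * g$2$1 ^ k)" if "n \<ge> 0"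
      unfolding w_def[symmetric]
      using nz 1 2 poly_line_bundle_P1[OF overlap that] poly_line_bundle_P1'[OF overlap that]
      by metis
    show "f g = 0" if "n < 0"
    proof -
      \<comment> \<open>For negative \<open>n\<close> the degree bound kills every coefficient,
        including the constant one.\<close>
      have "c w = 0"
        by (rule poly_eqI) (use that in \<open>auto intro: coeff_line_bundle_P1[OF overlap]\<close>)
      moreover have "c' w = 0"
      proof (rule poly_eqI_nonzero)
        fix u :: complex assume "u \<noteq> 0"
        then show "poly (c' w) u = poly 0 u" using overlap[of "1 / u" w] \<open>c w = 0\<close> by simp
      qed
      ultimately show ?thesis using nz 1 2 by auto
    qed
  qed
qed

lemma H0_G0_negative:
  assumes "f \<in> H0 G0 B0 (chi0 n)" and "n < 0"
  shows "f = 0"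
proof
  fix g show "f g = 0 g"
    using H0_outside[OF assms(1)] H0_G0_coefficients[OF assms(1)] assms(2)
    by (cases "g \<in> G0") auto
qed

text \<open>The coefficients, functions of q1 and q2, are homogenised to a common degree
  \<open>d\<close>; the monomials in x1 and x2 supply the degree in p.\<close>

lemma H0_G0_bihom:
  assumes f: "f \<in> H0 G0 B0 (chi0 n)" and "n \<ge> 0"
  shows "\<exists>d0. \<forall>d\<ge>d0. \<exists>F\<in>bihom (nat n) d. \<forall>g\<in>G0. f g = F (pq_of g)"
proof -
  obtain c where c: "\<And>k. (\<lambda>w. coeff (c w) k) \<in> poly_funs {fst, snd}"
    "\<And>g. g \<in> G0 \<Longrightarrow> n \<ge> 0 \<Longrightarrow> f g =
      (\<Sum>k\<le>nat n. coeff (c (snd (pq_of g) $ 1, snd (pq_of g) $ 2)) k * g$1$1 ^ (nat n - k) * g$2$1 ^ k)"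
    by (rule H0_G0_coefficients[OF f], rule that)
  have "\<forall>k. \<exists>d0. \<forall>d\<ge>d0. \<exists>F\<in>bihom 0 d. \<forall>w. q3 w = 1 \<longrightarrow>
      F w = coeff (c (snd w $ 1, snd w $ 2)) k"
    using homogenise[OF c(1)] by blast
  then obtain D where D: "\<And>k d. d \<ge> D k \<Longrightarrow> \<exists>F\<in>bihom 0 d. \<forall>w. q3 w = 1 \<longrightarrow>
      F w = coeff (c (snd w $ 1, snd w $ 2)) k"
    by metis
  show ?thesis
  \<comment> \<open>The sum of the finitely many thresholds \<open>D k\<close> serves as their
    common upper bound.\<close>
  proof (intro exI[of _ "\<Sum>k\<le>nat n. D k"] allI impI)
    fix d assume d: "d \<ge> (\<Sum>k\<le>nat n. D k)"
    have "\<exists>F\<in>bihom 0 d. \<forall>w. q3 w = 1 \<longrightarrow> F w = coeff (c (snd w $ 1, snd w $ 2)) k"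
      if "k \<le> nat n" for k
    proof (rule D)
      have "D k \<le> (\<Sum>k\<le>nat n. D k)" using that by (intro member_le_sum) auto
      then show "D k \<le> d" using d by simp
    qed
    then obtain C where C: "\<And>k. k \<le> nat n \<Longrightarrow> C k \<in> bihom 0 d"
      "\<And>k w. k \<le> nat n \<Longrightarrow> q3 w = 1 \<Longrightarrow> C k w = coeff (c (snd w $ 1, snd w $ 2)) k"
      by metis
    let ?F = "\<lambda>w. \<Sum>k\<le>nat n. C k w * fst w $ 1 ^ (nat n - k) * fst w $ 2 ^ k"
    have "(\<lambda>w. C k w * fst w $ 1 ^ (nat n - k) * fst w $ 2 ^ k) \<in> bihom (nat n) d"
      if "k \<le> nat n" for k
      using bihom_mult[OF bihom_mult[OF C(1)[OF that] bihom_power[OF bihom_p[of 1], of "nat n - k"]]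
          bihom_power[OF bihom_p[of 2], of k]] that by simp
    then have "?F \<in> bihom (nat n) d" by (intro bihom_sum) simp
    moreover have "f g = ?F (pq_of g)" if "g \<in> G0" for g
      unfolding c(2)[OF that assms(2)] fst_pq_of
      by (intro sum.cong refl) (simp add: C(2) q3_G0[OF that])
    ultimately show "\<exists>F\<in>bihom (nat n) d. \<forall>g\<in>G0. f g = F (pq_of g)"
      by (intro bexI[of _ ?F] ballI)
  qed
qed

section \<open>Reduction of sections over G1/B1 to G0/B0\<close>

lemma H0_G1_restrict_G0:
  assumes "f \<in> H0 G1 B1 (chi1 n m)"
  shows "on_set G0 f \<in> H0 G0 B0 (chi0 n)"
  using G0_subset_G1
  by (intro H0_restrict[OF assms] G0_mult) (auto simp: B0_def B1_def chi1_def chi0_def G0_def)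

text \<open>The factor \<open>diag(1, 1/q\<^sub>3, q\<^sub>3)\<close> in \<open>B1\<close> moves a point of \<open>G1\<close> into \<open>G0\<close>.\<close>

lemma H0_G1_from_G0:
  assumes f: "f \<in> H0 G1 B1 (chi1 n m)" and g: "g \<in> G1"
  obtains g' where "g' \<in> G0" and "f g = q3 (pq_of g) powi m * f g'"
    and "pq_of g' = (1 *s fst (pq_of g), inverse (q3 (pq_of g)) *s snd (pq_of g))"
proof -
  define r where "r = q3 (pq_of g)"
  have r: "r \<noteq> 0" using q3_G1_nonzero[OF g] by (simp add: r_def)
  define b :: mat3 where
    "b = mat_of_cols (vector [1, 0, 0]) (vector [0, inverse r, 0]) (vector [0, 0, r])"
  have b: "b \<in> B1" using r by (simp add: b_def B1_def B_def G1_def G_def det_3)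
  have "(g ** b)$3$3 = 1"
    using q3_G1[OF g] by (simp add: mat3_mult_nth b_def r_def mult.commute)
  then have "g ** b \<in> G0" using G1_mult[OF g b] by (simp add: G0_def G1_def)
  moreover have "f g = r powi m * f (g ** b)"
    using H0_equivariant[OF f g b] r by (simp add: chi1_def b_def)
  \<comment> \<open>The trivial factor \<open>1 *s\<close> matches the shape of
    \<open>bihom_scale\<close>.\<close>
  moreover have "pq_of (g ** b) = (1 *s fst (pq_of g), inverse r *s snd (pq_of g))"
    using pq_of_mult_B[of b g] b by (simp add: B1_def b_def)
  ultimately show thesis using that by (simp add: r_def)
qed

lemma H0_G1_negative:
  assumes "f \<in> H0 G1 B1 (chi1 n m)" and "n < 0"
  shows "f = 0"
proof
  fix g show "f g = 0 g"
  proof (cases "g \<in> G1")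
    case True
    then obtain g' where g': "g' \<in> G0" "f g = q3 (pq_of g) powi m * f g'"
      using H0_G1_from_G0[OF assms(1)] by metis
    have "f g' = on_set G0 f g'" using g' by (simp add: on_set_apply)
    also have "\<dots> = 0"
      using H0_G0_negative[OF H0_G1_restrict_G0[OF assms(1)] assms(2)] by simp
    finally show ?thesis using g' by simp
  qed (simp add: H0_outside[OF assms(1)])
qed

text \<open>Moving to \<open>G0\<close> divides q by \<open>q3\<close>, which costs q3^(-d) on a
  function of degree \<open>d\<close> in q, while equivariance contributes q3^m.\<close>

lemma H0_G1_bihom:
  assumes f: "f \<in> H0 G1 B1 (chi1 n m)" and "n \<ge> 0"
  shows "\<exists>d0. \<forall>d\<ge>d0. \<exists>F\<in>bihom (nat n) d.
    \<forall>g\<in>G1. f g = q3 (pq_of g) powi (m - int d) * F (pq_of g)"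
proof -
  obtain d0 where d0: "\<And>d. d \<ge> d0 \<Longrightarrow>
      \<exists>F\<in>bihom (nat n) d. \<forall>g\<in>G0. on_set G0 f g = F (pq_of g)"
    using H0_G0_bihom[OF H0_G1_restrict_G0[OF f] assms(2)] by blast
  show ?thesis
  proof (intro exI allI impI)
    fix d assume "d0 \<le> d"
    then obtain F where F: "F \<in> bihom (nat n) d" "\<And>g. g \<in> G0 \<Longrightarrow> on_set G0 f g = F (pq_of g)"
      using d0 by blast
    have "f g = q3 (pq_of g) powi (m - int d) * F (pq_of g)" if g: "g \<in> G1" for g
    proof -
      obtain g' where g': "g' \<in> G0" "f g = q3 (pq_of g) powi m * f g'"
        "pq_of g' = (1 *s fst (pq_of g), inverse (q3 (pq_of g)) *s snd (pq_of g))"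
        using H0_G1_from_G0[OF f g] by metis
      have "f g' = inverse (q3 (pq_of g)) ^ d * F (pq_of g)"
        using F(2)[OF g'(1)] g'(1) bihom_scale[OF F(1), of 1 "pq_of g" "inverse (q3 (pq_of g))"]
        by (simp add: on_set_apply g'(3))
      then show ?thesis
        using g'(2) q3_G1_nonzero[OF g]
        by (simp add: power_int_diff power_inverse divide_inverse)
    qed
    with F(1) show "\<exists>F\<in>bihom (nat n) d.
        \<forall>g\<in>G1. f g = q3 (pq_of g) powi (m - int d) * F (pq_of g)" by blast
  qed
qed

lemma H0_G1_fraction:
  assumes f: "f \<in> H0 G1 B1 (chi1 n m)" and "n \<ge> 0"
  obtains l F where "int l + m \<ge> 0" and "F \<in> bihom (nat n) (nat (int l + m))"
    and "\<And>g. g \<in> G1 \<Longrightarrow> f g = 1 / q3 (pq_of g) ^ l * F (pq_of g)"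
proof -
  obtain d0 where d0: "\<And>d. d \<ge> d0 \<Longrightarrow> \<exists>F\<in>bihom (nat n) d.
      \<forall>g\<in>G1. f g = q3 (pq_of g) powi (m - int d) * F (pq_of g)"
    using H0_G1_bihom[OF assms] by blast
  \<comment> \<open>The summand \<open>nat (- m)\<close> makes l + m nonnegative, and
    \<open>d0\<close> lifts it above the threshold.\<close>
  define l d where "l = nat (- m) + d0" and "d = nat (int l + m)"
  have d: "int d = int l + m" "d \<ge> d0" by (auto simp: l_def d_def)
  obtain F where F: "F \<in> bihom (nat n) d"
    "\<And>g. g \<in> G1 \<Longrightarrow> f g = q3 (pq_of g) powi (m - int d) * F (pq_of g)"
    using d0[OF d(2)] by blast
  show thesis
  proof (rule that)
    show "int l + m \<ge> 0" by (simp add: l_def)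
    show "F \<in> bihom (nat n) (nat (int l + m))" using F(1) by (simp add: d_def)
    have "m - int d = - int l" using d(1) by simp
    then show "f g = 1 / q3 (pq_of g) ^ l * F (pq_of g)" if "g \<in> G1" for g
      using F(2)[OF that] by (simp add: power_int_minus divide_inverse)
  qed
qed

section \<open>Isomorphisms induced by the pullback\<close>

lemma linear_pullback: "Vector_Spaces.linear fscale fscale (pullback H)"
  unfolding Vector_Spaces.linear_iff
  by (auto simp: pullback_def on_set_def fscale_def fun_eq_iff fun_space.vector_space_axioms)

lemma fscale_apply: "fscale c f x = c * f x"
  by (simp add: fscale_def)

lemma pullback_add: "pullback H (E + F) = pullback H E + pullback H F"
  and pullback_scale: "pullback H (fscale c F) = fscale c (pullback H F)"
  and pullback_zero: "pullback H 0 = 0"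
  by (auto simp: pullback_def on_set_def fscale_def fun_eq_iff)

lemma pullback_apply: "g \<in> H \<Longrightarrow> pullback H F g = F (pq_of g)"
  by (simp add: pullback_def on_set_def)

lemma pullback_on_set:
  assumes "\<And>g. g \<in> H \<Longrightarrow> pq_of g \<in> Y"
  shows "pullback H (on_set Y F) = pullback H F"
  unfolding pullback_def using assms by (intro on_set_eqI) (simp add: on_set_apply)

lemma subspace_image_pullback:
  "fun_space.subspace V \<Longrightarrow> fun_space.subspace (pullback H ` V)"
  using module_hom.subspace_image linear_pullback[of H] unfolding linear_iff_module_hom by blast

lemma linear_iso_pullback:
  assumes V: "fun_space.subspace V" and W: "pullback H ` V = W"
    and inj: "\<And>F. F \<in> V \<Longrightarrow> (\<And>g. g \<in> H \<Longrightarrow> F (pq_of g) = 0) \<Longrightarrow> F = 0"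
  shows "linear_iso (pullback H) V W"
proof -
  have "inj_on (pullback H) V"
  proof (rule inj_onI)
    fix E F assume EF: "E \<in> V" "F \<in> V" "pullback H E = pullback H F"
    have "E - F = 0"
    proof (rule inj)
      show "E - F \<in> V" using EF by (intro fun_space.subspace_diff V)
      fix g assume "g \<in> H"
      then show "(E - F) (pq_of g) = 0"
        using pullback_apply[of g H] EF(3) by (metis cancel_comm_monoid_add_class.diff_cancel minus_apply)
    qed
    then show "E = F" by simp
  qed
  then show ?thesis
    using V W subspace_image_pullback[OF V] linear_pullback
    by (auto simp: linear_iso_def bij_betw_def)
qed

text \<open>Surjectivity of \<open>pq_of\<close> onto \<open>Y\<close> makes the pullback injective
  on functions supported in \<open>Y\<close>. A union identified with this preimage of
  \<open>W\<close> is thereby known to be a subspace.\<close>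

lemma linear_iso_pullback_supported:
  assumes Y: "pq_of ` H = Y" and W: "fun_space.subspace W" "W \<subseteq> range (pullback H)"
  shows "linear_iso (pullback H) {E. on_set Y E = E \<and> pullback H E \<in> W} W"
proof (rule linear_iso_pullback)
  let ?V = "{E. on_set Y E = E \<and> pullback H E \<in> W}"
  show "fun_space.subspace ?V"
    by (rule fun_space.subspaceI)
       (auto simp: on_set_eq_self_iff pullback_add pullback_scale pullback_zero fscale_apply
         intro: fun_space.subspace_add fun_space.subspace_scale
         fun_space.subspace_0 W)
  show "pullback H ` ?V = W"
  proof (intro equalityI subsetI)
    fix f assume f: "f \<in> W"
    then obtain F where F: "f = pullback H F" using W(2) by blast
    then have "f = pullback H (on_set Y F)" using Y by (subst pullback_on_set) auto
    then show "f \<in> pullback H ` ?V" using f by (auto intro!: image_eqI simp: on_set_on_set)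
  qed auto
  fix E assume E: "E \<in> ?V" and 0: "\<And>g. g \<in> H \<Longrightarrow> E (pq_of g) = 0"
  show "E = 0"
  proof
    fix w show "E w = 0 w"
      using E 0 Y by (cases "w \<in> Y") (auto simp: on_set_eq_self_iff simp del: split_paired_All)
  qed
qed

section \<open>Sections as unions of spaces coming from G/B\<close>

lemma pq_of_image_G1: "pq_of ` G1 = G1U1" and pq_of_image_G0: "pq_of ` G0 = G0U0"
  using pq_of_in_G1U1 pq_of_in_G0U0 by (blast elim: pq_of_surj_G1 pq_of_surj_G0)+

lemma G1U1_subset_GU: "G1U1 \<subseteq> GU" and G0U0_subset_GU: "G0U0 \<subseteq> GU"
  by (auto simp: GU_def G1U1_def G0U0_def q3_def)

text \<open>The union equals the preimage of the sections under the pullback: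
  \<open>pullback_G1_divide_q3\<close> gives one inclusion and \<open>H0_G1_fraction\<close> the
  other.\<close>

lemma H0_G1_sections:
  assumes n: "n \<ge> 0"
  shows "linear_iso (pullback G1)
    (\<Union>l\<in>{nat (max 0 (- m))..}. (\<lambda>F. on_set G1U1 (\<lambda>w. 1 / q3 w ^ l * F w)) ` H0_GB_pq n (int l + m))
    (H0 G1 B1 (chi1 n m))"
proof -
  let ?W = "H0 G1 B1 (chi1 n m)"
  let ?V = "{E. on_set G1U1 E = E \<and> pullback G1 E \<in> ?W}"
  let ?U = "\<Union>l\<in>{nat (max 0 (- m))..}.
    (\<lambda>F. on_set G1U1 (\<lambda>w. 1 / q3 w ^ l * F w)) ` H0_GB_pq n (int l + m)"
  have VU: "?V = ?U"
  proof (intro equalityI subsetI)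
    fix E assume "E \<in> ?U"
    then obtain l F where E: "E = on_set G1U1 (\<lambda>w. 1 / q3 w ^ l * F w)"
        and "F \<in> H0_GB_pq n (int l + m)"
      by blast
    then have "pullback G1 (\<lambda>w. 1 / q3 w ^ l * F w) \<in> ?W"
      by (intro pullback_G1_divide_q3) (simp add: H0_GB_pq_def)
    then show "E \<in> ?V" by (simp add: E on_set_on_set pullback_on_set pq_of_in_G1U1)
  next
    fix E assume E: "E \<in> ?V"
    then obtain l F where l: "int l + m \<ge> 0" and F: "F \<in> bihom (nat n) (nat (int l + m))"
      and eq: "\<And>g. g \<in> G1 \<Longrightarrow> pullback G1 E g = 1 / q3 (pq_of g) ^ l * F (pq_of g)"
      using H0_G1_fraction[OF _ n] by blast
    have "E = on_set G1U1 (\<lambda>w. 1 / q3 w ^ l * on_set GU F w)"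
    proof
      fix w show "E w = on_set G1U1 (\<lambda>w. 1 / q3 w ^ l * on_set GU F w) w"
      proof (cases "w \<in> G1U1")
        case True
        then obtain g where "g \<in> G1" "pq_of g = w" by (rule pq_of_surj_G1)
        then show ?thesis
          using eq[of g] True G1U1_subset_GU by (auto simp: on_set_apply pullback_apply)
      next
        case False
        then show ?thesis
          using E by (simp add: on_set_outside on_set_eq_self_iff del: split_paired_All)
      qed
    qed
    moreover have "on_set GU F \<in> H0_GB_pq n (int l + m)"
      using bihom_H0_GB_pq[OF F] l n by simp
    \<comment> \<open>This is l + m \<ge> 0 rewritten as the lower bound of the union.\<close>
    moreover have "l \<in> {nat (max 0 (- m))..}" using l by simp
    ultimately show "E \<in> ?U" by blast
  qed
  have "?W \<subseteq> range (pullback G1)"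
  proof
    fix f assume f: "f \<in> ?W"
    show "f \<in> range (pullback G1)"
      by (rule H0_G1_fraction[OF f n], rule range_eqI, rule H0_eq_pullback[OF f])
  qed
  then show ?thesis
    unfolding VU[symmetric] by (rule linear_iso_pullback_supported[OF pq_of_image_G1 subspace_H0])
qed

text \<open>The character of \<open>B0\<close> fixes only the degree in p, so sections of every
  degree in q contribute, and at q3 = 1 no denominators remain.\<close>

lemma H0_G0_sections:
  assumes n: "n \<ge> 0"
  shows "linear_iso (pullback G0) (\<Union>l. on_set G0U0 ` H0_GB_pq n (int l)) (H0 G0 B0 (chi0 n))"
proof -
  let ?W = "H0 G0 B0 (chi0 n)"
  let ?V = "{E. on_set G0U0 E = E \<and> pullback G0 E \<in> ?W}"
  let ?U = "\<Union>l. on_set G0U0 ` H0_GB_pq n (int l)"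
  have VU: "?V = ?U"
  proof (intro equalityI subsetI)
    fix E assume "E \<in> ?U"
    then obtain l F where E: "E = on_set G0U0 F" and "F \<in> H0_GB_pq n (int l)"
      by blast
    then have "pullback G0 F \<in> ?W"
      by (intro pullback_G0[where m = "int l"]) (simp add: H0_GB_pq_def)
    then show "E \<in> ?V" by (simp add: E on_set_on_set pullback_on_set pq_of_in_G0U0)
  next
    fix E assume E: "E \<in> ?V"
    then obtain l F where F: "F \<in> bihom (nat n) l"
      and eq: "\<And>g. g \<in> G0 \<Longrightarrow> pullback G0 E g = F (pq_of g)"
      using H0_G0_bihom[OF _ n] by blast
    have "E = on_set G0U0 (on_set GU F)"
    proof
      fix w show "E w = on_set G0U0 (on_set GU F) w"
      proof (cases "w \<in> G0U0")
        case True
        then obtain g where "g \<in> G0" "pq_of g = w" by (rule pq_of_surj_G0)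
        then show ?thesis
          using eq[of g] True G0U0_subset_GU by (auto simp: on_set_apply pullback_apply)
      next
        case False
        then show ?thesis
          using E by (simp add: on_set_outside on_set_eq_self_iff del: split_paired_All)
      qed
    qed
    moreover have "on_set GU F \<in> H0_GB_pq n (int l)"
      using bihom_H0_GB_pq[OF F] n by simp
    ultimately show "E \<in> ?U" by blast
  qed
  have "?W \<subseteq> range (pullback G0)"
  proof
    fix f assume f: "f \<in> ?W"
    then obtain F where "\<And>g. g \<in> G0 \<Longrightarrow> f g = F (pq_of g)" using H0_G0_bihom[OF f n] by blast
    then show "f \<in> range (pullback G0)" using H0_eq_pullback[OF f] by blast
  qed
  then show ?thesis
    unfolding VU[symmetric] by (rule linear_iso_pullback_supported[OF pq_of_image_G0 subspace_H0])
qed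

section \<open>Infinite dimension over G1/B1\<close>

lemma H0_G1_chart1_polynomial:
  assumes "f \<in> H0 G1 B1 ch"
  obtains P where "\<And>s. f (chart1 0 (s, 0)) = poly P s"
proof -
  obtain P where P: "P \<in> poly_funs mat_coords" "f = on_set G1 P"
    using assms by (auto simp: H0_def regular_funs_def)
  have "\<exists>Q. \<forall>s. h (chart1 0 (s, 0)) = poly Q s" if h: "h \<in> mat_coords" for h
  proof -
    obtain i j where h: "h = (\<lambda>g. g $ i $ j)" using h by (auto simp: mat_coords_def)
    \<comment> \<open>Every entry is affine in \<open>s\<close>, hence determined by its values at 0
      and 1.\<close>
    have "chart1 0 (s, 0) $ i $ j = poly [:chart1 0 (0, 0) $ i $ j,
        chart1 0 (1, 0) $ i $ j - chart1 0 (0, 0) $ i $ j:] s" for s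
      using exhaust_3[of i] exhaust_3[of j] by (auto simp: chart1_def)
    then show ?thesis unfolding h by blast
  qed
  then obtain Q where "\<And>s. P (chart1 0 (s, 0)) = poly Q s"
    using poly_along_curve[OF P(1), of "\<lambda>s. chart1 0 (s, 0)"] by metis
  then show thesis using that chart1_G0 G0_subset_G1 by (auto simp: P(2) on_set_apply subset_iff)
qed

text \<open>
  On a finite dimensional space of sections the degree in \<open>q\<^sub>1\<close> would be bounded along the
  curve \<open>p = (1, 0, -s)\<close>, \<open>q = (s, 0, 1)\<close>.
\<close>

lemma H0_G1_infinite_dimensional:
  assumes n: "n \<ge> 0"
  shows "\<not> finite_dimensional (H0 G1 B1 (chi1 n m))"
proof
  let ?W = "H0 G1 B1 (chi1 n m)"
  assume "finite_dimensional ?W"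
  then obtain S where S: "finite S" "S \<subseteq> ?W" "?W \<subseteq> fun_space.span S"
    by (auto simp: finite_dimensional_def)
  have "\<forall>f\<in>S. \<exists>P. \<forall>s. f (chart1 0 (s, 0)) = poly P s"
    using S(2) H0_G1_chart1_polynomial by (meson subsetD)
  then obtain P where P: "\<And>f s. f \<in> S \<Longrightarrow> f (chart1 0 (s, 0)) = poly (P f) s"
    by metis
  define D where "D = (\<Sum>f\<in>S. degree (P f))"
  \<comment> \<open>The functions of degree at most \<open>D\<close> along the curve form a
    subspace, so the bound passes from \<open>S\<close> to its span.\<close>
  define T where "T = {f. \<exists>Q. degree Q \<le> D \<and> (\<forall>s. f (chart1 0 (s, 0)) = poly Q s)}"
  have "fun_space.subspace T"
  proof (rule fun_space.subspaceI)
    show "0 \<in> T" unfolding T_def by (auto intro: exI[of _ 0])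
  next
    fix f g assume "f \<in> T" "g \<in> T"
    then obtain Q Q' where "degree Q \<le> D" "\<forall>s. f (chart1 0 (s, 0)) = poly Q s"
      "degree Q' \<le> D" "\<forall>s. g (chart1 0 (s, 0)) = poly Q' s" by (auto simp: T_def)
    then show "f + g \<in> T"
      unfolding T_def by (auto intro!: exI[of _ "Q + Q'"] degree_add_le)
  next
    fix c f assume "f \<in> T"
    then obtain Q where "degree Q \<le> D" "\<forall>s. f (chart1 0 (s, 0)) = poly Q s" by (auto simp: T_def)
    then show "fscale c f \<in> T"
      unfolding T_def by (auto simp: fscale_def intro!: exI[of _ "smult c Q"] order.trans[OF degree_smult_le])
  qed
  moreover have "S \<subseteq> T"
  proof
    fix f assume f: "f \<in> S"
    then have "degree (P f) \<le> D" unfolding D_def by (intro member_le_sum S) auto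
    then show "f \<in> T" using P[OF f] by (auto simp: T_def)
  qed
  ultimately have T: "?W \<subseteq> T" using S(3) fun_space.span_minimal by blast
  \<comment> \<open>The term \<open>Suc D\<close> leaves room for \<open>Suc D\<close> factors q1
    within the degree \<open>d\<close>.\<close>
  define l d where "l = nat (- m) + Suc D" and "d = nat (int l + m)"
  have d: "int d = int l + m" "Suc D \<le> d" by (auto simp: l_def d_def)
  \<comment> \<open>On the curve p1 = q3 = 1 and q1 = s, so this function becomes s^(D + 1), just
    above the bound.\<close>
  let ?F = "\<lambda>w. fst w $ 1 ^ nat n * (snd w $ 1 ^ Suc D * q3 w ^ (d - Suc D)) :: complex"
  have "?F \<in> bihom (nat n) d"
    using bihom_mult[OF bihom_power[OF bihom_p[of 1], of "nat n"]
        bihom_mult[OF bihom_power[OF bihom_q[of 1], of "Suc D"] bihom_q3_power[of "d - Suc D"]]] d(2)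
    by simp
  then have "pullback G ?F \<in> H0 G B (chi n (int l + m))"
    using bihom_pullback_G d(1) n by fastforce
  then have "pullback G1 (\<lambda>w. 1 / q3 w ^ l * ?F w) \<in> T"
    using pullback_G1_divide_q3 T by blast
  then obtain Q where Q: "degree Q \<le> D"
    "\<And>s. pullback G1 (\<lambda>w. 1 / q3 w ^ l * ?F w) (chart1 0 (s, 0)) = poly Q s"
    by (auto simp: T_def)
  have "pullback G1 (\<lambda>w. 1 / q3 w ^ l * ?F w) (chart1 0 (s, 0)) = s ^ Suc D" for s
    using chart1_G0[of 0 "(s, 0)"] G0_subset_G1
    by (subst pullback_apply) (auto simp: q3_G0 pq_of_chart1 simp del: fst_pq_of snd_pq_of)
  then have "poly Q = poly (monom 1 (Suc D))"
    using Q(2) by (auto simp: fun_eq_iff poly_monom)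
  then have "Q = monom 1 (Suc D)" by (simp add: poly_eq_poly_eq_iff)
  then show False using Q(1) by (simp add: degree_monom_eq)
qed

section \<open>The graded algebras\<close>

lemma sum_fun_apply: "(\<Sum>j\<in>J. v j) x = (\<Sum>j\<in>J. v j x)"
  for v :: "'i \<Rightarrow> 'a \<Rightarrow> complex"
  by (induction J rule: infinite_finite_induct) auto

text \<open>Iterating \<open>r\<close> inserts P(\<mu> j) as weights into the vanishing sum, for any
  polynomial P. Choosing P with roots at all the other eigenvalues isolates
  \<open>v j\<close>.\<close>

lemma eigenfunctions_independent:
  fixes v :: "'i \<Rightarrow> 'a \<Rightarrow> complex"
  assumes J: "finite J" "inj_on \<mu> J" and r: "\<And>x. x \<in> X \<Longrightarrow> r x \<in> X"
    and eig: "\<And>j x. j \<in> J \<Longrightarrow> x \<in> X \<Longrightarrow> v j (r x) = \<mu> j * v j x"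
    and out: "\<And>j x. j \<in> J \<Longrightarrow> x \<notin> X \<Longrightarrow> v j x = 0"
    and sum: "(\<Sum>j\<in>J. v j) = 0" and j: "j \<in> J"
  shows "v j = 0"
proof
  fix x
  have poly: "(\<Sum>j\<in>J. poly P (\<mu> j) * v j x) = 0" if "x \<in> X" for P x
    using that
  proof (induction P arbitrary: x)
    \<comment> \<open>An extra factor of the variable corresponds to evaluating at
      \<open>r x\<close> instead of \<open>x\<close>.\<close>
    case (pCons a P)
    have "(\<Sum>j\<in>J. v j x) = 0" using sum sum_fun_apply[of v J x] by simp
    moreover have "(\<Sum>j\<in>J. poly P (\<mu> j) * (\<mu> j * v j x)) = 0"
      using pCons.IH[OF r[OF pCons.prems]] eig[OF _ pCons.prems] by simp
    ultimately show ?case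
      by (simp add: algebra_simps sum.distrib flip: sum_distrib_left)
  qed simp
  define P where "P = (\<Prod>i\<in>J - {j}. [:- \<mu> i, 1:])"
  have P0: "poly P (\<mu> i) = 0" if "i \<in> J - {j}" for i
    using that J by (auto simp: P_def poly_prod prod_zero_iff)
  have Pj: "poly P (\<mu> j) \<noteq> 0"
    using J j by (auto simp: P_def poly_prod prod_zero_iff inj_on_def)
  show "v j x = 0 x"
  proof (cases "x \<in> X")
    case True
    have "poly P (\<mu> j) * v j x = 0"
      using poly[OF True, of P] P0 by (simp add: sum.remove[OF J(1) j])
    then show ?thesis using Pj by simp
  qed (simp add: out j)
qed

text \<open>
  The sections of degree \<open>(n, m)\<close> over \<open>G1/B1\<close> are multiplied by \<open>2\<^sup>n 3\<^sup>-\<^sup>m\<close> under right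
  multiplication by \<open>diag(2, 1/6, 3)\<close>, and these numbers are distinct.
\<close>

lemma powi_2_eq_powi_3:
  assumes "(2::real) powi a = 3 powi b"
  shows "a = 0 \<and> b = 0"
proof -
  \<comment> \<open>Moving negative exponents across gives an identity of natural numbers, in which
    parity detects the sign of \<open>a\<close>.\<close>
  have eq: "(2::nat) ^ nat a * 3 ^ nat (- b) = 2 ^ nat (- a) * 3 ^ nat b"
  proof -
    have split: "(x::real) powi k = x ^ nat k / x ^ nat (- k)" for x k
      by (cases "k \<ge> 0") (auto simp: power_int_def power_inverse divide_inverse)
    have "(2::real) ^ nat a * 3 ^ nat (- b) = 2 ^ nat (- a) * 3 ^ nat b"
      using assms unfolding split by (simp add: field_simps)
    then have "real (2 ^ nat a * 3 ^ nat (- b)) = real (2 ^ nat (- a) * 3 ^ nat b)" by simp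
    then show ?thesis unfolding of_nat_eq_iff .
  qed
  have "even ((2::nat) ^ nat a * 3 ^ nat (- b)) \<longleftrightarrow> a > 0" by simp
  moreover have "even ((2::nat) ^ nat (- a) * 3 ^ nat b) \<longleftrightarrow> a < 0" by simp
  ultimately have a: "a = 0" using eq by (metis less_asym linorder_neqE_linordered_idom)
  then have "(3::nat) ^ nat (- b) = 3 ^ nat b" using eq by simp
  then have "nat (- b) = nat b" by (simp add: power_inject_exp)
  then show ?thesis using a by linarith
qed

text \<open>Norms carry the equation to the positive reals, where the powers of 2 and of 3 can be
  separated.\<close>

lemma powi_2_3_inject:
  assumes "(2::complex) powi a * inverse 3 powi b = 2 powi c * inverse 3 powi d"
  shows "a = c \<and> b = d"
proof -
  have norm: "norm ((2::complex) powi k * inverse 3 powi l) = 2 powi k / 3 powi l" for k l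
    by (simp only: norm_mult norm_power_int norm_inverse norm_numeral power_int_inverse divide_inverse)
  have "(2::real) powi a / 3 powi b = 2 powi c / 3 powi d"
    using arg_cong[OF assms, of norm] unfolding norm .
  then have "(2::real) powi (a - c) = 3 powi (b - d)"
    by (simp add: power_int_diff field_simps)
  then show ?thesis using powi_2_eq_powi_3[of "a - c" "b - d"] by simp
qed

text \<open>With the span as total space only independence remains to be shown;
  \<open>pullback_regular_G1\<close> identifies that span with the regular functions.\<close>

lemma direct_sum_G1:
  "is_direct_sum ({0..} \<times> UNIV) (\<lambda>(n, m). H0 G1 B1 (chi1 n m))
     (fun_space.span (\<Union>(n, m)\<in>{0..} \<times> UNIV. H0 G1 B1 (chi1 n m)))"
  unfolding is_direct_sum_def
proof (intro conjI ballI allI impI)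
  fix i :: "int \<times> int"
  show "fun_space.subspace (case i of (n, m) \<Rightarrow> H0 G1 B1 (chi1 n m))"
    by (cases i) (simp add: subspace_H0)
next
  fix J :: "(int \<times> int) set" and v :: "int \<times> int \<Rightarrow> mat3 \<Rightarrow> complex" and j
  assume "finite J \<and> J \<subseteq> {0..} \<times> UNIV \<and>
    (\<forall>j\<in>J. v j \<in> (case j of (n, m) \<Rightarrow> H0 G1 B1 (chi1 n m))) \<and> (\<Sum>j\<in>J. v j) = 0" and j: "j \<in> J"
  then have J: "finite J" "(\<Sum>j\<in>J. v j) = 0"
    and v: "\<And>j. j \<in> J \<Longrightarrow> v j \<in> H0 G1 B1 (chi1 (fst j) (snd j))"
    by (auto simp: case_prod_unfold)
  define b :: mat3 where
    "b = mat_of_cols (vector [2, 0, 0]) (vector [0, 1 / 6, 0]) (vector [0, 0, 3])"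
  have b: "b \<in> B1" by (simp add: b_def B1_def B_def G1_def G_def det_3)
  define \<mu> where "\<mu> = (\<lambda>i. (2::complex) powi fst i * inverse 3 powi snd i)"
  show "v j = 0"
  proof (rule eigenfunctions_independent[OF J(1), of \<mu> G1 "\<lambda>g. g ** b"])
    show "inj_on \<mu> J"
    proof (rule inj_onI)
      fix i j assume "\<mu> i = \<mu> j"
      then show "i = j"
        unfolding \<mu>_def using powi_2_3_inject by (blast intro: prod_eqI)
    qed
    show "v i (g ** b) = \<mu> i * v i g" if "i \<in> J" "g \<in> G1" for i g
      using H0_equivariant[OF v[OF that(1)] that(2) b]
      unfolding chi1_eq_chi inverse_chi by (simp add: b_def \<mu>_def)
  qed (use G1_mult b J j H0_outside[OF v] in auto)
qed (simp add: case_prod_unfold)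

lemma direct_sum_G0:
  "is_direct_sum {0..} (\<lambda>n. H0 G0 B0 (chi0 n)) (fun_space.span (\<Union>n\<in>{0..}. H0 G0 B0 (chi0 n)))"
  unfolding is_direct_sum_def
proof (intro conjI ballI allI impI)
  fix J :: "int set" and v :: "int \<Rightarrow> mat3 \<Rightarrow> complex" and j
  assume "finite J \<and> J \<subseteq> {0..} \<and>
    (\<forall>j\<in>J. v j \<in> H0 G0 B0 (chi0 j)) \<and> (\<Sum>j\<in>J. v j) = 0" and j: "j \<in> J"
  then have J: "finite J" "(\<Sum>j\<in>J. v j) = 0" and v: "\<And>j. j \<in> J \<Longrightarrow> v j \<in> H0 G0 B0 (chi0 j)"
    by auto
  \<comment> \<open>Right multiplication by diag(2, 1/2, 1) acts on sections of degree n by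
    2^n.\<close>
  define b :: mat3 where
    "b = mat_of_cols (vector [2, 0, 0]) (vector [0, 1 / 2, 0]) (vector [0, 0, 1])"
  have b: "b \<in> B0" by (simp add: b_def B0_def B_def G0_def G_def det_3)
  show "v j = 0"
  proof (rule eigenfunctions_independent[OF J(1), of "\<lambda>n. 2 powi n" G0 "\<lambda>g. g ** b"])
    show "inj_on (\<lambda>n. (2::complex) powi n) J"
      using powi_2_3_inject[of _ 0 _ 0] by (auto simp: inj_on_def)
    show "v i (g ** b) = 2 powi i * v i g" if "i \<in> J" "g \<in> G0" for i g
      using H0_equivariant[OF v[OF that(1)] that(2) b]
      by (simp add: chi0_def b_def power_int_minus)
  qed (use G0_mult b J j H0_outside[OF v] in auto)
qed (simp_all add: subspace_H0)

section \<open>Regular functions as spans of sections\<close>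

lemma span_bihom_mult:
  assumes "F \<in> fun_space.span (\<Union>a d. bihom a d)" and "F' \<in> fun_space.span (\<Union>a d. bihom a d)"
  shows "(\<lambda>w. F w * F' w) \<in> fun_space.span (\<Union>a d. bihom a d)"
proof -
  let ?S = "fun_space.span (\<Union>a d. bihom a d)"
  have sub: "fun_space.subspace {F. (\<lambda>w. F w * F' w) \<in> ?S}" for F'
  proof (rule fun_space.subspaceI)
    show "0 \<in> {F. (\<lambda>w. F w * F' w) \<in> ?S}"
      using fun_space.span_zero by (simp add: zero_fun_def)
    show "E + F \<in> {F. (\<lambda>w. F w * F' w) \<in> ?S}"
      if "E \<in> {F. (\<lambda>w. F w * F' w) \<in> ?S}" "F \<in> {F. (\<lambda>w. F w * F' w) \<in> ?S}" for E F
      using fun_space.span_add that by (fastforce simp: plus_fun_def algebra_simps)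
    show "fscale c F \<in> {F. (\<lambda>w. F w * F' w) \<in> ?S}" if "F \<in> {F. (\<lambda>w. F w * F' w) \<in> ?S}" for c F
      using fun_space.span_scale that by (fastforce simp: fscale_def mult.assoc)
  qed
  have base: "(\<lambda>w. E w * F w) \<in> ?S" if "E \<in> (\<Union>a d. bihom a d)" "F \<in> (\<Union>a d. bihom a d)" for E F
  proof -
    from that obtain a d a' d' where "E \<in> bihom a d" "F \<in> bihom a' d'" by blast
    then have "(\<lambda>w. E w * F w) \<in> bihom (a + a') (d + d')" by (rule bihom_mult)
    then show ?thesis by (intro fun_space.span_base) blast
  qed
  \<comment> \<open>Bilinearity is used one factor at a time: first the second factor ranges over
    the span with the first a generator, then the first factor is extended to the span.\<close>
  have "(\<lambda>w. F w * F' w) \<in> ?S" if F: "F \<in> (\<Union>a d. bihom a d)" for F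
  proof -
    have "(\<lambda>w. F' w * F w) \<in> ?S"
      by (rule fun_space.span_induct[OF assms(2) sub]) (rule base[OF _ F])
    then show ?thesis by (simp add: mult.commute)
  qed
  then show ?thesis by (rule fun_space.span_induct[OF assms(1) sub])
qed

lemma poly_span_bihom:
  assumes "F \<in> poly_funs pq_coords"
  shows "F \<in> fun_space.span (\<Union>a d. bihom a d)"
  using assms
proof (induction rule: poly_funs.induct)
  case (const c)
  show ?case using bihom_const by (intro fun_space.span_base) blast
next
  case (coord f)
  then show ?case
    using bihom_p bihom_q by (intro fun_space.span_base) (auto simp: pq_coords_def)
next
  case (add f g)
  then show ?case using fun_space.span_add by (fastforce simp: plus_fun_def)
next
  case (mult f g)
  then show ?case by (intro span_bihom_mult)
qed

text \<open>Points with \<open>p = 0\<close> are limits of points with \<open>p \<noteq> 0\<close> and the same \<open>q\<close>.\<close>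

lemma poly_zero_at_p_0:
  assumes F: "F \<in> poly_funs pq_coords" and "q3 w \<noteq> 0" "p_dot_q w = 0"
    and zero: "\<And>p. p \<noteq> 0 \<Longrightarrow> p_dot_q (p, snd w) = 0 \<Longrightarrow> F (p, snd w) = 0"
  shows "F w = 0"
proof (cases "fst w = 0")
  case False
  then show ?thesis using zero[of "fst w"] assms(3) by simp
next
  case True
  \<comment> \<open>A vector orthogonal to q, nonzero because its first entry is
    \<open>q3 w\<close>.\<close>
  define p :: "complex^3" where "p = vector [q3 w, 0, - (snd w $ 1)]"
  have "\<exists>P. \<forall>t. h (t *s p, snd w) = poly P t" if "h \<in> pq_coords" for h
  proof -
    from that consider i where "h = (\<lambda>w. fst w $ i)" | i where "h = (\<lambda>w. snd w $ i)"
      by (auto simp: pq_coords_def)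
    then show ?thesis
    proof cases
      case 1
      then show ?thesis by (intro exI[of _ "[:0, p $ i:]"]) simp
    next
      case 2
      then show ?thesis by (intro exI[of _ "[:snd w $ i:]"]) simp
    qed
  qed
  then obtain P where P: "\<And>t. F (t *s p, snd w) = poly P t"
    using poly_along_curve[OF F, of "\<lambda>t. (t *s p, snd w)"] by metis
  have "P = 0"
  proof (rule poly_eqI_nonzero)
    fix t :: complex assume "t \<noteq> 0"
    then have "t *s p \<noteq> 0" using assms(2) by (auto simp: vec_eq_iff forall_3 p_def)
    moreover have "p_dot_q (t *s p, snd w) = 0"
      by (simp add: p_dot_q_def sum_3 p_def q3_def)
    ultimately have "F (t *s p, snd w) = 0" by (rule zero)
    then show "poly P t = poly 0 t" by (simp add: P)
  qed
  moreover have "w = (0 *s p, snd w)" using True by (simp add: prod_eq_iff)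
  ultimately show ?thesis using P[of 0] by (metis poly_0)
qed

lemma poly_q3: "q3 \<in> poly_funs pq_coords"
  by (intro poly_funs.coord) (auto simp: pq_coords_def q3_def fun_eq_iff)

lemma subspace_regular_funs_principal:
  assumes h: "h \<in> poly_funs C"
  shows "fun_space.subspace (regular_funs_principal C X h)"
proof (rule fun_space.subspaceI)
  show "0 \<in> regular_funs_principal C X h"
    unfolding regular_funs_principal_def
    by (intro CollectI exI[of _ "\<lambda>_. 0"]) (auto simp: on_set_def fun_eq_iff intro: poly_funs.const)
next
  fix f g assume "f \<in> regular_funs_principal C X h" "g \<in> regular_funs_principal C X h"
  then obtain F k F' l where F: "F \<in> poly_funs C" "F' \<in> poly_funs C"
    and fg: "f = on_set (X \<inter> {w. h w \<noteq> 0}) (\<lambda>w. F w / h w ^ k)"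
      "g = on_set (X \<inter> {w. h w \<noteq> 0}) (\<lambda>w. F' w / h w ^ l)"
    by (auto simp: regular_funs_principal_def)
  have "f + g = on_set (X \<inter> {w. h w \<noteq> 0}) (\<lambda>w. (F w * h w ^ l + F' w * h w ^ k) / h w ^ (k + l))"
    by (auto simp: fg on_set_def fun_eq_iff field_simps power_add)
  moreover have "(\<lambda>w. F w * h w ^ l + F' w * h w ^ k) \<in> poly_funs C"
    by (intro poly_funs.add poly_funs.mult poly_funs_power F h)
  ultimately show "f + g \<in> regular_funs_principal C X h"
    unfolding regular_funs_principal_def by (intro CollectI exI conjI)
next
  fix c f assume "f \<in> regular_funs_principal C X h"
  then obtain F k where F: "F \<in> poly_funs C" and f: "f = on_set (X \<inter> {w. h w \<noteq> 0}) (\<lambda>w. F w / h w ^ k)"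
    by (auto simp: regular_funs_principal_def)
  have "fscale c f = on_set (X \<inter> {w. h w \<noteq> 0}) (\<lambda>w. c * F w / h w ^ k)"
    by (auto simp: f on_set_def fun_eq_iff fscale_def)
  moreover have "(\<lambda>w. c * F w) \<in> poly_funs C" by (rule poly_funs_cmult[OF F])
  ultimately show "fscale c f \<in> regular_funs_principal C X h"
    unfolding regular_funs_principal_def by (intro CollectI exI conjI)
qed

text \<open>Sections are fractions with denominator a power of \<open>q3\<close>; conversely a
  numerator splits into bihomogeneous parts, each giving a section. Injectivity has to reach the
  points with p = 0, which \<open>pq_of\<close> misses, through
  \<open>poly_zero_at_p_0\<close>.\<close>

lemma pullback_regular_G1:
  "linear_iso (pullback G1) (regular_funs_principal pq_coords G1U1_closure q3)
     (fun_space.span (\<Union>(n, m)\<in>{0..} \<times> UNIV. H0 G1 B1 (chi1 n m)))"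
proof (rule linear_iso_pullback)
  let ?X = "G1U1_closure \<inter> {w. q3 w \<noteq> 0}"
  let ?R = "regular_funs_principal pq_coords G1U1_closure q3"
  let ?U = "\<Union>(n, m)\<in>{0..} \<times> UNIV. H0 G1 B1 (chi1 n m)"
  show sub: "fun_space.subspace ?R" by (rule subspace_regular_funs_principal[OF poly_q3])
  have X: "pq_of g \<in> ?X" if "g \<in> G1" for g
    using that by (simp add: G1U1_closure_def p_dot_q_pq_of q3_G1_nonzero)
  show "pullback G1 ` ?R = fun_space.span ?U"
  proof (intro equalityI)
    have "?U \<subseteq> pullback G1 ` ?R"
    proof
      fix f assume "f \<in> ?U"
      then obtain n m where f: "f \<in> H0 G1 B1 (chi1 n m)" and n: "n \<ge> 0" by auto
      obtain l F where F: "F \<in> bihom (nat n) (nat (int l + m))"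
        "\<And>g. g \<in> G1 \<Longrightarrow> f g = 1 / q3 (pq_of g) ^ l * F (pq_of g)"
        using H0_G1_fraction[OF f n] by metis
      have "f = pullback G1 (\<lambda>w. F w / q3 w ^ l)"
        using F(2) by (intro H0_eq_pullback[OF f]) simp
      also have "\<dots> = pullback G1 (on_set ?X (\<lambda>w. F w / q3 w ^ l))"
        using pullback_on_set[of G1 ?X, OF X] by simp
      finally show "f \<in> pullback G1 ` ?R"
        using bihom_poly[OF F(1)] by (auto simp: regular_funs_principal_def)
    qed
    then show "fun_space.span ?U \<subseteq> pullback G1 ` ?R"
      by (intro fun_space.span_minimal subspace_image_pullback sub)
  next
    show "pullback G1 ` ?R \<subseteq> fun_space.span ?U"
    proof
      fix f assume "f \<in> pullback G1 ` ?R"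
      then obtain F l where F: "F \<in> poly_funs pq_coords"
        and f: "f = pullback G1 (on_set ?X (\<lambda>w. F w / q3 w ^ l))"
        by (auto simp: regular_funs_principal_def)
      have subspace: "fun_space.subspace {F. pullback G1 (\<lambda>w. F w / q3 w ^ l) \<in> fun_space.span ?U}"
      proof (rule fun_space.subspaceI; unfold mem_Collect_eq)
        have "pullback G1 (\<lambda>w. (0::pq \<Rightarrow> complex) w / q3 w ^ l) = 0"
          by (auto simp: pullback_def on_set_def fun_eq_iff)
        then show "pullback G1 (\<lambda>w. (0::pq \<Rightarrow> complex) w / q3 w ^ l) \<in> fun_space.span ?U"
          by (simp add: fun_space.span_zero)
      next
        fix E F assume "pullback G1 (\<lambda>w. E w / q3 w ^ l) \<in> fun_space.span ?U"
          "pullback G1 (\<lambda>w. F w / q3 w ^ l) \<in> fun_space.span ?U"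
        then have "pullback G1 (\<lambda>w. E w / q3 w ^ l) + pullback G1 (\<lambda>w. F w / q3 w ^ l)
            \<in> fun_space.span ?U"
          by (rule fun_space.span_add)
        also have "pullback G1 (\<lambda>w. E w / q3 w ^ l) + pullback G1 (\<lambda>w. F w / q3 w ^ l)
            = pullback G1 (\<lambda>w. (E + F) w / q3 w ^ l)"
          by (auto simp: pullback_def on_set_def fun_eq_iff add_divide_distrib)
        finally show "pullback G1 (\<lambda>w. (E + F) w / q3 w ^ l) \<in> fun_space.span ?U" .
      next
        fix c F assume "pullback G1 (\<lambda>w. F w / q3 w ^ l) \<in> fun_space.span ?U"
        then have "fscale c (pullback G1 (\<lambda>w. F w / q3 w ^ l)) \<in> fun_space.span ?U"
          by (rule fun_space.span_scale)
        also have "fscale c (pullback G1 (\<lambda>w. F w / q3 w ^ l))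
            = pullback G1 (\<lambda>w. fscale c F w / q3 w ^ l)"
          by (auto simp: pullback_def on_set_def fun_eq_iff fscale_apply)
        finally show "pullback G1 (\<lambda>w. fscale c F w / q3 w ^ l) \<in> fun_space.span ?U" .
      qed
      have base: "pullback G1 (\<lambda>w. F w / q3 w ^ l) \<in> fun_space.span ?U"
        if "F \<in> (\<Union>a d. bihom a d)" for F
      proof -
        from that obtain a d where "F \<in> bihom a d" by blast
        \<comment> \<open>The second degree is written as l + (d - l), because division by q3^l
          lowers it to d - l, possibly a negative number.\<close>
        then have "pullback G F \<in> H0 G B (chi (int a) (int l + (int d - int l)))"
          using bihom_pullback_G by simp
        then have "pullback G1 (\<lambda>w. 1 / q3 w ^ l * F w) \<in> H0 G1 B1 (chi1 (int a) (int d - int l))"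
          by (rule pullback_G1_divide_q3)
        then show ?thesis by (intro fun_space.span_base) force
      qed
      have "pullback G1 (\<lambda>w. F w / q3 w ^ l) \<in> fun_space.span ?U"
        by (rule fun_space.span_induct[OF poly_span_bihom[OF F] subspace base])
      then show "f \<in> fun_space.span ?U"
        unfolding f using pullback_on_set[of G1 ?X, OF X] by simp
    qed
  qed
  fix E assume "E \<in> ?R" and zero: "\<And>g. g \<in> G1 \<Longrightarrow> E (pq_of g) = 0"
  then obtain F l where F: "F \<in> poly_funs pq_coords" and E: "E = on_set ?X (\<lambda>w. F w / q3 w ^ l)"
    by (auto simp: regular_funs_principal_def)
  have F0: "F w = 0" if w: "w \<in> G1U1" for w
  proof -
    obtain g where "g \<in> G1" "pq_of g = w" using pq_of_surj_G1[OF w] by blast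
    then show ?thesis using zero[of g] X[of g] by (auto simp: E on_set_apply)
  qed
  have "F w = 0" if w: "w \<in> ?X" for w
    by (rule poly_zero_at_p_0[OF F]) (use w F0 in \<open>auto simp: G1U1_def G1U1_closure_def q3_def\<close>)
  then show "E = 0" by (auto simp: E on_set_def fun_eq_iff)
qed

text \<open>The argument for \<open>G1\<close> with q3 = 1: a part of bidegree (a, d) restricts to a
  section of degree a, whatever d is.\<close>

lemma pullback_regular_G0:
  "linear_iso (pullback G0) (regular_funs pq_coords G0U0_closure)
     (fun_space.span (\<Union>n\<in>{0..}. H0 G0 B0 (chi0 n)))"
proof (rule linear_iso_pullback)
  let ?X = G0U0_closure
  let ?R = "regular_funs pq_coords ?X"
  let ?U = "\<Union>n\<in>{0..}. H0 G0 B0 (chi0 n)"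
  show sub: "fun_space.subspace ?R" by (rule subspace_regular_funs)
  have X: "pq_of g \<in> ?X" if "g \<in> G0" for g
    using that by (simp add: G0U0_closure_def p_dot_q_pq_of q3_G0)
  show "pullback G0 ` ?R = fun_space.span ?U"
  proof (intro equalityI)
    have "?U \<subseteq> pullback G0 ` ?R"
    proof
      fix f assume "f \<in> ?U"
      then obtain n where f: "f \<in> H0 G0 B0 (chi0 n)" and n: "n \<ge> 0" by auto
      obtain d F where F: "F \<in> bihom (nat n) d" "\<And>g. g \<in> G0 \<Longrightarrow> f g = F (pq_of g)"
        using H0_G0_bihom[OF f n] by blast
      have "f = pullback G0 F" by (intro H0_eq_pullback[OF f] F(2))
      also have "\<dots> = pullback G0 (on_set ?X F)"
        using pullback_on_set[of G0 ?X, OF X] by simp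
      finally show "f \<in> pullback G0 ` ?R"
        using bihom_poly[OF F(1)] by (auto simp: regular_funs_def)
    qed
    then show "fun_space.span ?U \<subseteq> pullback G0 ` ?R"
      by (intro fun_space.span_minimal subspace_image_pullback sub)
  next
    show "pullback G0 ` ?R \<subseteq> fun_space.span ?U"
    proof
      fix f assume "f \<in> pullback G0 ` ?R"
      then obtain F where F: "F \<in> poly_funs pq_coords" and f: "f = pullback G0 (on_set ?X F)"
        by (auto simp: regular_funs_def)
      have subspace: "fun_space.subspace {F. pullback G0 F \<in> fun_space.span ?U}"
        by (rule fun_space.subspaceI)
           (auto simp: pullback_add pullback_scale pullback_zero
             intro: fun_space.span_add fun_space.span_scale fun_space.span_zero)
      have base: "pullback G0 F \<in> fun_space.span ?U" if "F \<in> (\<Union>a d. bihom a d)" for F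
      proof -
        from that obtain a d where "F \<in> bihom a d" by blast
        then have "pullback G0 F \<in> H0 G0 B0 (chi0 (int a))"
          using bihom_pullback_G pullback_G0 by blast
        then show ?thesis by (intro fun_space.span_base) force
      qed
      have "pullback G0 F \<in> fun_space.span ?U"
        by (rule fun_space.span_induct[OF poly_span_bihom[OF F] subspace base])
      then show "f \<in> fun_space.span ?U"
        unfolding f using pullback_on_set[of G0 ?X, OF X] by simp
    qed
  qed
  fix E assume "E \<in> ?R" and zero: "\<And>g. g \<in> G0 \<Longrightarrow> E (pq_of g) = 0"
  then obtain F where F: "F \<in> poly_funs pq_coords" and E: "E = on_set ?X F"
    by (auto simp: regular_funs_def)
  have F0: "F w = 0" if w: "w \<in> G0U0" for w
  proof -
    obtain g where "g \<in> G0" "pq_of g = w" using pq_of_surj_G0[OF w] by blast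
    then show ?thesis using zero[of g] X[of g] by (auto simp: E on_set_apply)
  qed
  have "F w = 0" if w: "w \<in> ?X" for w
    by (rule poly_zero_at_p_0[OF F]) (use w F0 in \<open>auto simp: G0U0_def G0U0_closure_def q3_def\<close>)
  then show "E = 0" by (auto simp: E on_set_def fun_eq_iff)
qed

section \<open>Vanishing in negative degrees and assembly of the statements\<close>

lemma isomorphic_zero: "isomorphic {0} {0}"
proof -
  have "linear_iso (\<lambda>_. 0) {0} {0}"
    by (auto simp: linear_iso_def Vector_Spaces.linear_iff fun_space.vector_space_axioms
        bij_betw_def fun_space.subspace_def)
  then show ?thesis by (auto simp: isomorphic_def)
qed

lemma H0_negative:
  assumes "n < 0"
  shows "H0 G1 B1 (chi1 n m) = {0}" and "H0 G0 B0 (chi0 n) = {0}"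
  using H0_G1_negative H0_G0_negative assms fun_space.subspace_0[OF subspace_H0] by blast+

theorem theorem2:
  "(\<forall>n1 n2 :: int. n1 < 0 \<longrightarrow>
      isomorphic (H0 G1 B1 (chi1 n1 n2)) (H0 G0 B0 (chi0 n1)) \<and>
      H0 G0 B0 (chi0 n1) = {0}) \<and>
   (\<forall>n1 n2 :: int. n1 \<ge> 0 \<longrightarrow>
      \<not> finite_dimensional (H0 G1 B1 (chi1 n1 n2)) \<and>
      linear_iso (pullback G1)
        (\<Union>l\<in>{nat (max 0 (- n2))..}.
           (\<lambda>F. on_set G1U1 (\<lambda>w. 1 / q3 w ^ l * F w)) ` H0_GB_pq n1 (int l + n2))
        (H0 G1 B1 (chi1 n1 n2))) \<and>
   (\<exists>W. is_direct_sum ({0..} \<times> UNIV) (\<lambda>(n1, n2). H0 G1 B1 (chi1 n1 n2)) W \<and>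
      linear_iso (pullback G1) (regular_funs_principal pq_coords G1U1_closure q3) W) \<and>
   (\<forall>n1 :: int. n1 \<ge> 0 \<longrightarrow>
      linear_iso (pullback G0)
        (\<Union>l. on_set G0U0 ` H0_GB_pq n1 (int l))
        (H0 G0 B0 (chi0 n1))) \<and>
   (\<exists>W. is_direct_sum {0..} (\<lambda>n1. H0 G0 B0 (chi0 n1)) W \<and>
      linear_iso (pullback G0) (regular_funs pq_coords G0U0_closure) W)"
proof (intro conjI allI impI)
  fix n1 n2 :: int assume "n1 < 0"
  then show "isomorphic (H0 G1 B1 (chi1 n1 n2)) (H0 G0 B0 (chi0 n1))" "H0 G0 B0 (chi0 n1) = {0}"
    by (simp_all add: H0_negative isomorphic_zero)
next
  show "\<exists>W. is_direct_sum ({0..} \<times> UNIV) (\<lambda>(n1, n2). H0 G1 B1 (chi1 n1 n2)) W \<and>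
      linear_iso (pullback G1) (regular_funs_principal pq_coords G1U1_closure q3) W"
    using direct_sum_G1 pullback_regular_G1 by blast
  show "\<exists>W. is_direct_sum {0..} (\<lambda>n1. H0 G0 B0 (chi0 n1)) W \<and>
      linear_iso (pullback G0) (regular_funs pq_coords G0U0_closure) W"
    using direct_sum_G0 pullback_regular_G0 by blast
qed (simp_all only: H0_G1_infinite_dimensional H0_G1_sections H0_G0_sections not_False_eq_True)

end
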